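(* Let $k\ge 2$ and $n\ge 1$ be integers. The zero operator is the only compact $k^{th}$ order slant Hankel operator of level $n$ on $L^2(\mathbb{T}^n)$.
   Context: $\mathbb{T}^n$ is the $n$-torus with normalized Haar measure; $e_m(z)=z^m=z_1^{m_1}\cdots z_n^{m_n}$ for $m\in\mathbb{Z}^n$, an orthonormal basis of $L^2(\mathbb{T}^n)$. For $m\in\mathbb{Z}^n$, $k\mid m$ means $k$ divides every component of $m$. Let $\mathcal{V}_k^n$ be the bounded linear operator on $L^2(\mathbb{T}^n)$ with $\mathcal{V}_k^n e_m=e_{-m/k}$ if $k\mid m$ and $\mathcal{V}_k^n e_m=0$ otherwise. For $\phi\in L^\infty(\mathbb{T}^n)$, $M_\phi$ is multiplication by $\phi$ and $\mathcal{S}_\phi^{k,n}=\mathcal{V}_k^nM_\phi$. A $k^{th}$ order slant Hankel operator of level $n$ on $L^2(\mathbb{T}^n)$ is an operator of the form $\mathcal{S}_\phi^{k,n}$ for some $\phi\in L^\infty(\mathbb{T}^n)$. *)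

theory Defs
  imports "HOL-Probability.Probability"
begin

text \<open>
  The \<open>n\<close>-torus is modelled with coordinates indexed by a finite type \<open>'n\<close>, so that
  \<open>n = CARD('n) \<ge> 1\<close>. Its normalized Haar measure is the product of the normalized
  arc length measures on the unit circle.
\<close>

definition circle :: "complex measure" where
  "circle = distr (uniform_measure lborel {0..1}) (restrict_space borel (sphere 0 1))
              (\<lambda>t. cis (2 * pi * t))"

definition torus :: "('n::finite \<Rightarrow> complex) measure" where
  "torus = (\<Pi>\<^sub>M i\<in>UNIV. circle)"

lemma space_circle [simp]: "space circle = sphere 0 1"
  by (simp add: circle_def space_restrict_space)

lemma sets_circle [measurable_cong]: "sets circle = sets (restrict_space borel (sphere 0 1))"
  by (simp add: circle_def)

lemma prob_space_circle: "prob_space circle"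
proof -
  interpret prob_space "uniform_measure lborel {0..1::real}"
    by (rule prob_space_uniform_measure) auto
  show ?thesis
    unfolding circle_def
  proof (rule prob_space_distr)
    show "(\<lambda>t. cis (2 * pi * t)) \<in> uniform_measure lborel {0..1} \<rightarrow>\<^sub>M restrict_space borel (sphere 0 1)"
    proof (rule measurable_restrict_space2)
      have "(\<lambda>t::real. cis (2 * pi * t)) \<in> borel_measurable borel"
        by (intro borel_measurable_continuous_onI continuous_intros)
      thus "(\<lambda>t. cis (2 * pi * t)) \<in> borel_measurable (uniform_measure lborel {0..1})"
        by (simp add: measurable_def)
    qed auto
  qed
qed

lemma prob_space_torus: "prob_space (torus :: ('n::finite \<Rightarrow> complex) measure)"
  unfolding torus_def by (intro prob_space_PiM prob_space_circle)

lemma norm_torus: "z \<in> space torus \<Longrightarrow> norm (z i) = 1"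
  by (auto simp: torus_def space_PiM PiE_def Pi_def)

lemma measurable_torus_component [measurable]: "(\<lambda>z. z i) \<in> borel_measurable torus"
proof -
  have "(\<lambda>z. z i) \<in> torus \<rightarrow>\<^sub>M restrict_space borel (sphere 0 1)"
    unfolding torus_def by (subst measurable_cong_sets[OF refl sets_circle[symmetric]]) measurable
  thus ?thesis by (simp add: measurable_restrict_space2_iff)
qed


text \<open>\<open>L\<^sup>2\<close> and \<open>L\<^sup>\<infinity>\<close> of the torus, as spaces of functions modulo equality almost everywhere.\<close>

definition square_integrable :: "(('n::finite \<Rightarrow> complex) \<Rightarrow> complex) \<Rightarrow> bool" where
  "square_integrable f \<longleftrightarrow>
     f \<in> borel_measurable torus \<and> integrable torus (\<lambda>z. (norm (f z))\<^sup>2)"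

definition ess_bounded :: "(('n::finite \<Rightarrow> complex) \<Rightarrow> complex) \<Rightarrow> bool" where
  "ess_bounded f \<longleftrightarrow>
     f \<in> borel_measurable torus \<and> (\<exists>C. AE z in torus. norm (f z) \<le> C)"

lemma square_integrable_0: "square_integrable (\<lambda>_. 0)"
  by (simp add: square_integrable_def)

lemma square_integrable_add:
  assumes "square_integrable f" "square_integrable g"
  shows "square_integrable (\<lambda>z. f z + g z)"
proof -
  have [measurable]: "f \<in> borel_measurable torus" "g \<in> borel_measurable torus"
    and int: "integrable torus (\<lambda>z. (norm (f z))\<^sup>2)" "integrable torus (\<lambda>z. (norm (g z))\<^sup>2)"
    using assms by (auto simp: square_integrable_def)
  have "integrable torus (\<lambda>z. (norm (f z + g z))\<^sup>2)"
  proof (rule Bochner_Integration.integrable_bound)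
    show "integrable torus (\<lambda>z. 2 * (norm (f z))\<^sup>2 + 2 * (norm (g z))\<^sup>2)"
      using int by simp
    have "(norm (f z + g z))\<^sup>2 \<le> 2 * (norm (f z))\<^sup>2 + 2 * (norm (g z))\<^sup>2" for z
    proof -
      have "(norm (f z + g z))\<^sup>2 \<le> (norm (f z) + norm (g z))\<^sup>2"
        by (intro power_mono norm_triangle_ineq norm_ge_zero)
      also have "\<dots> \<le> 2 * (norm (f z))\<^sup>2 + 2 * (norm (g z))\<^sup>2"
        using zero_le_power2[of "norm (f z) - norm (g z)"]
        by (simp add: power2_eq_square algebra_simps)
      finally show ?thesis .
    qed
    thus "AE z in torus. norm ((norm (f z + g z))\<^sup>2) \<le> norm (2 * (norm (f z))\<^sup>2 + 2 * (norm (g z))\<^sup>2)"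
      by simp
  qed measurable
  thus ?thesis by (simp add: square_integrable_def)
qed

lemma square_integrable_mult:
  assumes "ess_bounded \<phi>" "square_integrable f"
  shows "square_integrable (\<lambda>z. \<phi> z * f z)"
proof -
  have [measurable]: "f \<in> borel_measurable torus" "\<phi> \<in> borel_measurable torus"
    and int: "integrable torus (\<lambda>z. (norm (f z))\<^sup>2)"
    using assms by (auto simp: square_integrable_def ess_bounded_def)
  obtain C where C: "AE z in torus. norm (\<phi> z) \<le> C"
    using assms by (auto simp: ess_bounded_def)
  have "integrable torus (\<lambda>z. (norm (\<phi> z * f z))\<^sup>2)"
  proof (rule Bochner_Integration.integrable_bound)
    show "integrable torus (\<lambda>z. C\<^sup>2 * (norm (f z))\<^sup>2)"
      using int by simp
    show "AE z in torus. norm ((norm (\<phi> z * f z))\<^sup>2) \<le> norm (C\<^sup>2 * (norm (f z))\<^sup>2)"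
      using C
    proof eventually_elim
      case (elim z)
      hence "(norm (\<phi> z))\<^sup>2 \<le> C\<^sup>2" by (intro power_mono) auto
      thus ?case by (simp add: norm_mult power_mult_distrib mult_right_mono)
    qed
  qed measurable
  thus ?thesis by (simp add: square_integrable_def)
qed

lemma ess_bounded_const: "ess_bounded (\<lambda>_. c)"
  by (auto simp: ess_bounded_def)

lemma square_integrable_cmult: "square_integrable f \<Longrightarrow> square_integrable (\<lambda>z. c * f z)"
  by (rule square_integrable_mult[OF ess_bounded_const])

lemma borel_measurable_cnj [measurable (raw)]:
  "f \<in> borel_measurable M \<Longrightarrow> (\<lambda>x. cnj (f x)) \<in> borel_measurable M"
  by (rule borel_measurable_continuous_on[of cnj]) (intro continuous_intros)

lemma integrable_mult_cnj:
  assumes "square_integrable f" "square_integrable g"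
  shows "integrable torus (\<lambda>z. f z * cnj (g z))"
proof -
  have [measurable]: "f \<in> borel_measurable torus" "g \<in> borel_measurable torus"
    and int: "integrable torus (\<lambda>z. (norm (f z))\<^sup>2)" "integrable torus (\<lambda>z. (norm (g z))\<^sup>2)"
    using assms by (auto simp: square_integrable_def)
  show ?thesis
  proof (rule Bochner_Integration.integrable_bound)
    show "integrable torus (\<lambda>z. (norm (f z))\<^sup>2 + (norm (g z))\<^sup>2)"
      using int by simp
    have "norm (f z * cnj (g z)) \<le> (norm (f z))\<^sup>2 + (norm (g z))\<^sup>2" for z
    proof -
      have "2 * (norm (f z) * norm (g z)) \<le> (norm (f z))\<^sup>2 + (norm (g z))\<^sup>2"
        using zero_le_power2[of "norm (f z) - norm (g z)"]
        by (simp add: power2_eq_square algebra_simps)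
      moreover have "0 \<le> norm (f z) * norm (g z)" by simp
      ultimately show ?thesis unfolding norm_mult complex_mod_cnj by linarith
    qed
    thus "AE z in torus. norm (f z * cnj (g z)) \<le> norm ((norm (f z))\<^sup>2 + (norm (g z))\<^sup>2)"
      by simp
  qed measurable
qed

definition L2_rel :: "(('n::finite \<Rightarrow> complex) \<Rightarrow> complex) \<Rightarrow> (('n \<Rightarrow> complex) \<Rightarrow> complex) \<Rightarrow> bool" where
  "L2_rel f g \<longleftrightarrow> square_integrable f \<and> square_integrable g \<and> (AE z in torus. f z = g z)"

definition Linf_rel :: "(('n::finite \<Rightarrow> complex) \<Rightarrow> complex) \<Rightarrow> (('n \<Rightarrow> complex) \<Rightarrow> complex) \<Rightarrow> bool" where
  "Linf_rel f g \<longleftrightarrow> ess_bounded f \<and> ess_bounded g \<and> (AE z in torus. f z = g z)"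

quotient_type 'n torus_L2 = "('n::finite \<Rightarrow> complex) \<Rightarrow> complex" / partial: L2_rel
proof (rule part_equivpI)
  show "\<exists>f. L2_rel f f" using square_integrable_0 by (auto simp: L2_rel_def)
  show "symp L2_rel" by (auto simp: L2_rel_def symp_def)
  show "transp L2_rel" by (auto simp: L2_rel_def transp_def elim: AE_mp)
qed

quotient_type 'n torus_Linf = "('n::finite \<Rightarrow> complex) \<Rightarrow> complex" / partial: Linf_rel
proof (rule part_equivpI)
  show "\<exists>f. Linf_rel f f" using ess_bounded_const by (auto simp: Linf_rel_def)
  show "symp Linf_rel" by (auto simp: Linf_rel_def symp_def)
  show "transp Linf_rel" by (auto simp: Linf_rel_def transp_def elim: AE_mp)
qed

lift_definition scaleC_L2 :: "complex \<Rightarrow> 'n::finite torus_L2 \<Rightarrow> 'n torus_L2" (infixr \<open>*\<^sub>C\<close> 75)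
  is "\<lambda>c f z. c * f z"
  by (auto simp: L2_rel_def square_integrable_cmult)

instantiation torus_L2 :: (finite) real_inner
begin

lift_definition zero_torus_L2 :: "'a torus_L2" is "\<lambda>_. 0"
  by (simp add: L2_rel_def square_integrable_0)

lift_definition plus_torus_L2 :: "'a torus_L2 \<Rightarrow> 'a torus_L2 \<Rightarrow> 'a torus_L2" is "\<lambda>f g z. f z + g z"
  by (auto simp: L2_rel_def square_integrable_add)

definition uminus_torus_L2 :: "'a torus_L2 \<Rightarrow> 'a torus_L2" where
  "- f = (-1) *\<^sub>C f"

definition minus_torus_L2 :: "'a torus_L2 \<Rightarrow> 'a torus_L2 \<Rightarrow> 'a torus_L2" where
  "f - g = f + (- g :: 'a torus_L2)"

definition scaleR_torus_L2 :: "real \<Rightarrow> 'a torus_L2 \<Rightarrow> 'a torus_L2" where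
  "scaleR_torus_L2 r f = complex_of_real r *\<^sub>C f"

text \<open>
  The class wants a real inner product; this is the real part of the Hermitian inner product
  of \<open>L\<^sup>2\<close>, and induces the same norm.
\<close>
lift_definition inner_torus_L2 :: "'a torus_L2 \<Rightarrow> 'a torus_L2 \<Rightarrow> real"
  is "\<lambda>f g. Re (\<integral>z. f z * cnj (g z) \<partial>torus)"
proof -
  fix f f' g g' :: "('a \<Rightarrow> complex) \<Rightarrow> complex"
  assume *: "L2_rel f f'" "L2_rel g g'"
  have [measurable]: "f \<in> borel_measurable torus" "f' \<in> borel_measurable torus"
     "g \<in> borel_measurable torus" "g' \<in> borel_measurable torus"
    using * by (auto simp: L2_rel_def square_integrable_def)
  have "(\<integral>z. f z * cnj (g z) \<partial>torus) = (\<integral>z. f' z * cnj (g' z) \<partial>torus)"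
  proof (rule integral_cong_AE)
    show "AE z in torus. f z * cnj (g z) = f' z * cnj (g' z)"
      using * by (auto simp: L2_rel_def)
  qed measurable
  thus "Re (\<integral>z. f z * cnj (g z) \<partial>torus) = Re (\<integral>z. f' z * cnj (g' z) \<partial>torus)" by simp
qed

definition norm_torus_L2 :: "'a torus_L2 \<Rightarrow> real" where
  "norm_torus_L2 f = sqrt (inner f f)"

definition sgn_torus_L2 :: "'a torus_L2 \<Rightarrow> 'a torus_L2" where
  "sgn_torus_L2 f = inverse (norm f) *\<^sub>R f"

definition dist_torus_L2 :: "'a torus_L2 \<Rightarrow> 'a torus_L2 \<Rightarrow> real" where
  "dist_torus_L2 f g = norm (f - g)"

definition uniformity_torus_L2 :: "('a torus_L2 \<times> 'a torus_L2) filter" where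
  "uniformity_torus_L2 = (INF e\<in>{0<..}. principal {(f, g). dist f g < e})"

definition open_torus_L2 :: "'a torus_L2 set \<Rightarrow> bool" where
  "open_torus_L2 U \<longleftrightarrow> (\<forall>f\<in>U. \<forall>\<^sub>F (f', g) in uniformity. f' = f \<longrightarrow> g \<in> U)"

instance
proof
  fix f g h :: "'a torus_L2" and r s :: real
  show "f + g + h = f + (g + h)" 
    by transfer (auto simp: L2_rel_def add.assoc intro!: square_integrable_add)
  show "f + g = g + f" 
    by transfer (auto simp: L2_rel_def add.commute intro!: square_integrable_add)
  show "0 + f = f" 
    by transfer (auto simp: L2_rel_def)
  show "- f + f = 0" unfolding uminus_torus_L2_def
    by transfer (auto simp: L2_rel_def square_integrable_0)
  show "f - g = f + - g" by (simp add: minus_torus_L2_def)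
  show "r *\<^sub>R (f + g) = r *\<^sub>R f + r *\<^sub>R g" unfolding scaleR_torus_L2_def
    by transfer (auto simp: L2_rel_def distrib_left intro!: square_integrable_add square_integrable_cmult)
  show "(r + s) *\<^sub>R f = r *\<^sub>R f + s *\<^sub>R f" unfolding scaleR_torus_L2_def
    by transfer (auto simp: L2_rel_def distrib_right intro!: square_integrable_add square_integrable_cmult)
  show "r *\<^sub>R s *\<^sub>R f = (r * s) *\<^sub>R f" unfolding scaleR_torus_L2_def
    by transfer (auto simp: L2_rel_def mult.assoc intro!: square_integrable_cmult)
  show "1 *\<^sub>R f = f" unfolding scaleR_torus_L2_def
    by transfer (auto simp: L2_rel_def)
  show "dist f g = norm (f - g)" by (rule dist_torus_L2_def)
  show "sgn f = inverse (norm f) *\<^sub>R f" by (rule sgn_torus_L2_def)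
  show "uniformity = (INF e\<in>{0<..}. principal {(f, g :: 'a torus_L2). dist f g < e})"
    by (rule uniformity_torus_L2_def)
  show "open U \<longleftrightarrow> (\<forall>f\<in>U. \<forall>\<^sub>F (f', g) in uniformity. f' = f \<longrightarrow> g \<in> U)" for U :: "'a torus_L2 set"
    by (rule open_torus_L2_def)
  show "inner f g = inner g f"
  proof transfer
    fix f g :: "('a \<Rightarrow> complex) \<Rightarrow> complex"
    have "Re (\<integral>z. f z * cnj (g z) \<partial>torus) = Re (cnj (\<integral>z. f z * cnj (g z) \<partial>torus))" by simp
    also have "\<dots> = Re (\<integral>z. g z * cnj (f z) \<partial>torus)"
      by (subst Bochner_Integration.integral_cnj[symmetric]) (simp add: mult.commute)
    finally show "Re (\<integral>z. f z * cnj (g z) \<partial>torus) = Re (\<integral>z. g z * cnj (f z) \<partial>torus)" .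
  qed
  show "inner (f + g) h = inner f h + inner g h"
    by transfer (simp add: L2_rel_def distrib_right integrable_mult_cnj)
  show "inner (r *\<^sub>R f) g = r * inner f g" unfolding scaleR_torus_L2_def
    by transfer (simp add: mult.assoc)
  have Re: "Re (\<integral>z. f z * cnj (f z) \<partial>torus) = (\<integral>z. (norm (f z))\<^sup>2 \<partial>torus)"
    for f :: "('a \<Rightarrow> complex) \<Rightarrow> complex"
    by (simp only: complex_norm_square[symmetric] integral_complex_of_real Re_complex_of_real)
  show "0 \<le> inner f f"
    by transfer (simp only: Re, simp)
  show "inner f f = 0 \<longleftrightarrow> f = 0"
    by transfer (simp only: Re, auto simp: L2_rel_def square_integrable_def integral_nonneg_eq_0_iff_AE)
  show "norm f = sqrt (inner f f)" by (rule norm_torus_L2_def)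
qed

end

lift_definition monomial :: "('n::finite \<Rightarrow> int) \<Rightarrow> 'n torus_L2"
  is "\<lambda>m z. \<Prod>i\<in>UNIV. z i powi m i"
proof -
  fix m :: "'n \<Rightarrow> int"
  interpret prob_space "torus :: ('n \<Rightarrow> complex) measure" by (rule prob_space_torus)
  have [measurable]: "(\<lambda>z. \<Prod>i\<in>UNIV. z i powi m i) \<in> borel_measurable torus"
    unfolding power_int_def by measurable
  have "integrable torus (\<lambda>z. (norm (\<Prod>i\<in>UNIV. z i powi m i))\<^sup>2)"
    by (rule Bochner_Integration.integrable_cong[THEN iffD1, OF refl _ integrable_const[of 1]])
       (simp add: prod_norm[symmetric] norm_power_int norm_torus)
  thus "L2_rel (\<lambda>z. \<Prod>i\<in>UNIV. z i powi m i) (\<lambda>z. \<Prod>i\<in>UNIV. z i powi m i)"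
    by (simp add: L2_rel_def square_integrable_def)
qed

lift_definition mult_op :: "'n::finite torus_Linf \<Rightarrow> 'n torus_L2 \<Rightarrow> 'n torus_L2"
  is "\<lambda>\<phi> f z. \<phi> z * f z"
  by (auto simp: L2_rel_def Linf_rel_def intro!: square_integrable_mult)


definition complex_linear :: "('n::finite torus_L2 \<Rightarrow> 'n torus_L2) \<Rightarrow> bool" where
  "complex_linear T \<longleftrightarrow>
     (\<forall>f g. T (f + g) = T f + T g) \<and> (\<forall>c f. T (c *\<^sub>C f) = c *\<^sub>C T f)"

definition bounded_operator :: "('n::finite torus_L2 \<Rightarrow> 'n torus_L2) \<Rightarrow> bool" where
  "bounded_operator T \<longleftrightarrow> complex_linear T \<and> (\<exists>C. \<forall>f. norm (T f) \<le> C * norm f)"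

definition compact_operator :: "('n::finite torus_L2 \<Rightarrow> 'n torus_L2) \<Rightarrow> bool" where
  "compact_operator T \<longleftrightarrow> complex_linear T \<and> (\<forall>B. bounded B \<longrightarrow> compact (closure (T ` B)))"

text \<open>
  The description is proper for \<open>k \<ge> 1\<close>: the monomials are an orthonormal basis, and
  \<open>m \<mapsto> - m / k\<close> is injective on the multi-indices divisible by \<open>k\<close>.
\<close>
definition V_op :: "nat \<Rightarrow> 'n::finite torus_L2 \<Rightarrow> 'n torus_L2" where
  "V_op k = (THE V. bounded_operator V \<and>
     (\<forall>m. V (monomial m) =
        (if \<forall>i. int k dvd m i then monomial (\<lambda>i. - (m i div int k)) else 0)))"

definition slant_Hankel :: "nat \<Rightarrow> 'n::finite torus_Linf \<Rightarrow> 'n torus_L2 \<Rightarrow> 'n torus_L2" where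
  "slant_Hankel k \<phi> = V_op k \<circ> mult_op \<phi>"

definition slant_Hankel_operator :: "nat \<Rightarrow> ('n::finite torus_L2 \<Rightarrow> 'n torus_L2) \<Rightarrow> bool" where
  "slant_Hankel_operator k T \<longleftrightarrow> (\<exists>\<phi>. T = slant_Hankel k \<phi>)"

end

theory Submission
  imports Defs "HOL-Complex_Analysis.Cauchy_Integral_Theorem"
begin

text \<open>
  Trigonometric polynomials generate all bounded measurable functions under bounded pointwise
  limits (Stone-Weierstrass and a monotone class argument). Hence a map of the torus preserves
  Haar measure as soon as the nontrivial characters composed with it have integral zero, and
  the monomials are total in \<open>L\<^sup>2\<close>.

  The operator \<open>V_op k\<close> averages a function over the fibres of \<open>z \<mapsto> z\<^sup>-\<^sup>k\<close>; it is a contraction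
  because this map preserves the measure, and
  \<open>\<langle>V f, e\<^sub>j\<rangle> = \<langle>f, e\<^bsub>-kj\<^esub>\<rangle>\<close>.

  For \<open>T = V M\<^sub>\<phi>\<close> this makes \<open>\<langle>T e\<^bsub>q-kt\<^esub>, e\<^sub>t\<rangle>\<close>, where \<open>t\<close> is a constant multi-index, equal to the
  Fourier coefficient of \<open>\<phi>\<close> at \<open>-q\<close> for every \<open>t\<close>. If \<open>T\<close> is compact, a subsequence of \<open>T e\<^bsub>q-kt\<^esub>\<close>
  converges in norm, while the orthonormal vectors \<open>e\<^sub>t\<close> tend weakly to \<open>0\<close>. So all Fourier
  coefficients of \<open>\<phi>\<close> vanish and \<open>\<phi> = 0\<close>.
\<close>

subsection \<open>Characters and bounded measurable functions\<close>

text \<open>The representative of \<open>monomial m\<close> before passing to classes, for which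
  pointwise identities can be stated.\<close>

definition torus_char :: "('n::finite \<Rightarrow> int) \<Rightarrow> ('n \<Rightarrow> complex) \<Rightarrow> complex" where
  "torus_char m z = (\<Prod>i\<in>UNIV. z i powi m i)"

lemma space_torus: "space torus = (UNIV :: 'n::finite set) \<rightarrow>\<^sub>E sphere 0 1"
  by (simp add: torus_def space_PiM)

lemma in_space_torus_iff: "z \<in> space torus \<longleftrightarrow> (\<forall>i::'n::finite. norm (z i) = 1)"
  by (auto simp: space_torus PiE_def Pi_def)

lemma torus_component_nonzero: "z \<in> space torus \<Longrightarrow> z i \<noteq> 0"
  using norm_torus[of z i] by auto

lemma measurable_torus_char [measurable]: "torus_char m \<in> borel_measurable torus"
  unfolding torus_char_def power_int_def by measurable

lemma norm_torus_char: "z \<in> space torus \<Longrightarrow> norm (torus_char m z) = 1"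
  by (simp add: torus_char_def prod_norm[symmetric] norm_power_int norm_torus)

lemma torus_char_0 [simp]: "torus_char (\<lambda>_. 0) z = 1"
  by (simp add: torus_char_def)

lemma torus_char_add:
  "z \<in> space torus \<Longrightarrow> torus_char (\<lambda>i. m i + l i) z = torus_char m z * torus_char l z"
  by (simp add: torus_char_def prod.distrib power_int_add torus_component_nonzero)

text \<open>On the unit circle conjugation is inversion, so it negates every exponent.\<close>

lemma cnj_torus_char:
  assumes "z \<in> space torus"
  shows "cnj (torus_char m z) = torus_char (\<lambda>i. - m i) z"
proof -
  have "cnj (z i) = inverse (z i)" for i
    using complex_norm_square[of "z i"] norm_torus[OF assms, of i]
    by (intro inverse_unique[symmetric]) simp
  moreover have "cnj (w powi a) = cnj w powi a" for w a
    by (simp add: power_int_def)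
  ultimately show ?thesis
    by (simp add: torus_char_def power_int_minus power_int_inverse)
qed

lemma torus_char_single: "torus_char (\<lambda>j. if j = i then a else 0) z = z i powi a"
proof -
  have "torus_char (\<lambda>j. if j = i then a else 0) z = (\<Prod>j\<in>UNIV. if j = i then z j powi a else 1)"
    unfolding torus_char_def by (intro prod.cong) auto
  thus ?thesis by simp
qed

section \<open>Trigonometric polynomials and their uniform density\<close>

inductive trig_poly :: "(('n::finite \<Rightarrow> complex) \<Rightarrow> complex) \<Rightarrow> bool" where
  trig_poly_char: "trig_poly (\<lambda>z. c * torus_char m z)"
| trig_poly_add: "trig_poly p \<Longrightarrow> trig_poly q \<Longrightarrow> trig_poly (\<lambda>z. p z + q z)"

text \<open>Exponents add only for nonzero coordinates: at 0, exponents of opposite sign fail to.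
  Hence a witness \<open>r\<close> that agrees with the product on the torus alone.\<close>

lemma trig_poly_mult_char:
  assumes "trig_poly p"
  shows "\<exists>r. trig_poly r \<and> (\<forall>z\<in>space torus. r z = p z * (c * torus_char m z))"
  using assms
proof (induction rule: trig_poly.induct)
  case (trig_poly_char d l)
  show ?case
    by (rule exI[of _ "\<lambda>z. (c * d) * torus_char (\<lambda>i. m i + l i) z"])
       (auto simp: torus_char_add intro: trig_poly.trig_poly_char)
next
  case (trig_poly_add p q)
  then obtain r s where "trig_poly r" "\<forall>z\<in>space torus. r z = p z * (c * torus_char m z)"
    "trig_poly s" "\<forall>z\<in>space torus. s z = q z * (c * torus_char m z)" by blast
  thus ?case
    by (intro exI[of _ "\<lambda>z. r z + s z"]) (auto simp: distrib_right intro: trig_poly.trig_poly_add)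
qed

lemma trig_poly_mult:
  assumes "trig_poly q" "trig_poly p"
  shows "\<exists>r. trig_poly r \<and> (\<forall>z\<in>space torus. r z = p z * q z)"
  using assms
proof (induction rule: trig_poly.induct)
  case (trig_poly_char d l)
  thus ?case by (rule trig_poly_mult_char)
next
  case (trig_poly_add q q')
  then obtain r s where "trig_poly r" "\<forall>z\<in>space torus. r z = p z * q z"
    "trig_poly s" "\<forall>z\<in>space torus. s z = p z * q' z" by blast
  thus ?case
    by (intro exI[of _ "\<lambda>z. r z + s z"]) (auto simp: distrib_left intro: trig_poly.trig_poly_add)
qed

lemma continuous_on_torus_char: "continuous_on (space torus) (torus_char m)"
  unfolding torus_char_def
  by (intro continuous_intros continuous_on_subset[OF continuous_on_product_coordinates] subset_UNIV)
     (simp add: torus_component_nonzero)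

lemma continuous_on_trig_poly: "trig_poly p \<Longrightarrow> continuous_on (space torus) p"
  by (induction rule: trig_poly.induct) (auto intro!: continuous_intros continuous_on_torus_char)

lemma compact_space_torus: "compact (space torus :: ('n::finite \<Rightarrow> complex) set)"
proof -
  have "compactin (product_topology (\<lambda>_::'n. euclidean) UNIV) (UNIV \<rightarrow>\<^sub>E sphere (0::complex) 1)"
    by (subst compactin_PiE) auto
  thus ?thesis by (simp add: space_torus euclidean_product_topology)
qed

text \<open>Stone-Weierstrass for the real functions that coincide on the torus with a trigonometric
  polynomial: they form an algebra, contain the constants, and separate points through the real and
  imaginary parts of the coordinates.\<close>

lemma trig_poly_dense:
  fixes g :: "('n::finite \<Rightarrow> complex) \<Rightarrow> real"
  assumes "continuous_on (space torus) g" "e > 0"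
  shows "\<exists>p. trig_poly p \<and> (\<forall>z\<in>space torus. norm (of_real (g z) - p z) < e)"
proof -
  define R where "R = {h. \<exists>p. trig_poly p \<and> (\<forall>z\<in>space (torus :: ('n \<Rightarrow> complex) measure). of_real (h z) = p z)}"
  have const: "trig_poly (\<lambda>_::'n \<Rightarrow> complex. c)" for c
    using trig_poly_char[of c "\<lambda>_. 0"] by simp
  \<comment> \<open>The choices 1 and \<open>\<i>\<close> for \<open>c\<close> give the real part
    and minus the imaginary part of a coordinate. Each is half the sum of a number and its
    conjugate, which brings in the exponents 1 and -1.\<close>
  have Re: "(\<lambda>z. Re (c * z i)) \<in> R" for c i
  proof -
    let ?a = "\<lambda>z. c / 2 * torus_char (\<lambda>j. if j = i then 1 else 0) z"
    let ?b = "\<lambda>z. cnj c / 2 * torus_char (\<lambda>j. if j = i then -1 else 0) z"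
    have "trig_poly (\<lambda>z. ?a z + ?b z)" by (intro trig_poly.intros)
    moreover have "\<forall>z\<in>space (torus :: ('n \<Rightarrow> complex) measure). of_real (Re (c * z i)) = ?a z + ?b z"
    proof
      fix z assume z: "z \<in> space (torus :: ('n \<Rightarrow> complex) measure)"
      have "?b z = cnj (?a z)" 
        using z by (simp add: cnj_torus_char if_distrib cong: if_cong)
      moreover have "?a z = c * z i / 2" by (simp add: torus_char_single)
      ultimately have "?a z + ?b z = c * z i / 2 + cnj (c * z i / 2)" by presburger
      also have "\<dots> = of_real (Re (c * z i))" by (subst complex_add_cnj) simp
      finally show "of_real (Re (c * z i)) = ?a z + ?b z" ..
    qed
    ultimately show ?thesis unfolding R_def by blast
  qed
  interpret function_ring_on R "space torus"
  proof
    show "compact (space torus :: ('n \<Rightarrow> complex) set)" by (rule compact_space_torus)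
  next
    fix f assume "f \<in> R"
    then obtain p where p: "trig_poly p" "\<forall>z\<in>space torus. of_real (f z) = p z" by (auto simp: R_def)
    hence "continuous_on (space torus) (\<lambda>z. Re (p z))" 
      by (intro continuous_intros continuous_on_trig_poly)
    moreover have "Re (p z) = f z" if "z \<in> space torus" for z using p that by (metis Re_complex_of_real)
    ultimately show "continuous_on (space torus) f" by (simp cong: continuous_on_cong)
  next
    fix f g assume "f \<in> R" "g \<in> R"
    then obtain p q where p: "trig_poly p" "\<forall>z\<in>space torus. of_real (f z) = p z"
      and q: "trig_poly q" "\<forall>z\<in>space torus. of_real (g z) = q z" by (auto simp: R_def)
    show "(\<lambda>x. f x + g x) \<in> R" unfolding R_def using p q
      by (auto intro!: exI[of _ "\<lambda>z. p z + q z"] trig_poly_add)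
    show "(\<lambda>x. f x * g x) \<in> R" unfolding R_def using p q trig_poly_mult[OF q(1) p(1)] by auto
  next
    fix c show "(\<lambda>_. c) \<in> R" unfolding R_def using const[of "of_real c"] by auto
  next
    fix x y :: "'n \<Rightarrow> complex"
    assume "x \<noteq> y"
    then obtain i where i: "x i \<noteq> y i" by auto
    hence "Re (1 * x i) \<noteq> Re (1 * y i) \<or> Re (\<i> * x i) \<noteq> Re (\<i> * y i)" by (simp add: complex_eq_iff)
    thus "\<exists>f\<in>R. f x \<noteq> f y"
      by (elim disjE) (rule bexI[OF _ Re], assumption)+
  qed
  from Stone_Weierstrass_basic[OF assms] obtain h where h: "h \<in> R" "\<forall>x\<in>space torus. \<bar>g x - h x\<bar> < e" by blast
  then obtain p where p: "trig_poly p" "\<forall>z\<in>space torus. of_real (h z) = p z" by (auto simp: R_def)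
  have "norm (of_real (g z) - p z) < e" if z: "z \<in> space torus" for z
  proof -
    have "norm (of_real (g z) - p z) = norm (of_real (g z - h z) :: complex)" using p z by simp
    also have "\<dots> < e" using h z by (simp only: norm_of_real)
    finally show ?thesis .
  qed
  with p show ?thesis by blast
qed

section \<open>Borel structure of the torus and the monotone class principle\<close>

lemma measurable_torusI:
  fixes f :: "'a \<Rightarrow> 'n::finite \<Rightarrow> complex"
  assumes [measurable]: "\<And>i. (\<lambda>x. f x i) \<in> borel_measurable M"
    and "\<And>i x. x \<in> space M \<Longrightarrow> norm (f x i) = 1"
  shows "f \<in> M \<rightarrow>\<^sub>M torus"
proof -
  have "(\<lambda>x. f x i) \<in> M \<rightarrow>\<^sub>M circle" for i
    by (subst measurable_cong_sets[OF refl sets_circle])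
       (use assms in \<open>auto intro!: measurable_restrict_space2\<close>)
  thus ?thesis unfolding torus_def using assms(2) by (intro measurable_PiM_single') auto
qed

text \<open>Links the product sigma-algebra to the topology of the function space, so that closed
  sets can serve as generators.\<close>

lemma sets_torus_borel_vimage:
  assumes "A \<in> sets (torus :: ('n::finite \<Rightarrow> complex) measure)"
  shows "\<exists>B\<in>sets borel. A = B \<inter> space torus"
proof -
  \<comment> \<open>A measurable retraction onto the torus; coordinates off the unit circle go to
    the arbitrary unit value 1.\<close>
  define r :: "('n \<Rightarrow> complex) \<Rightarrow> 'n \<Rightarrow> complex" where "r z i = (if norm (z i) = 1 then z i else 1)" for z i
  have [measurable]: "(\<lambda>z. z i) \<in> borel_measurable borel" for i :: 'n
    by (intro borel_measurable_continuous_onI continuous_on_product_coordinates)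
  have "r \<in> borel \<rightarrow>\<^sub>M torus"
    by (rule measurable_torusI) (auto simp: r_def)
  from measurable_sets[OF this assms] have "r -` A \<in> sets borel" by simp
  moreover have "r z = z" if "z \<in> space torus" for z
    using that by (auto simp: r_def in_space_torus_iff)
  hence "A = r -` A \<inter> space torus" using sets.sets_into_space[OF assms] by auto
  ultimately show ?thesis by blast
qed

text \<open>A functional monotone class argument. Real continuous functions are uniform limits of
  trigonometric polynomials, indicators of closed sets are limits of continuous functions, a Dynkin
  argument passes to all measurable sets, and simple functions approximate the rest. The rule
  \<open>lim\<close> asks only for uniformly bounded pointwise limits, the setting of dominated
  convergence.\<close>

theorem torus_bounded_measurable_induct [consumes 2, case_names char cmult add lim]:
  fixes f :: "('n::finite \<Rightarrow> complex) \<Rightarrow> complex"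
  assumes f: "f \<in> borel_measurable torus" "\<exists>C. \<forall>z\<in>space torus. norm (f z) \<le> C"
    and char: "\<And>m. P (torus_char m)"
    and cmult: "\<And>c f. f \<in> borel_measurable torus \<Longrightarrow> (\<exists>C. \<forall>z\<in>space torus. norm (f z) \<le> C) \<Longrightarrow>
                  P f \<Longrightarrow> P (\<lambda>z. c * f z)"
    and add: "\<And>f g. f \<in> borel_measurable torus \<Longrightarrow> (\<exists>C. \<forall>z\<in>space torus. norm (f z) \<le> C) \<Longrightarrow> P f \<Longrightarrow>
                g \<in> borel_measurable torus \<Longrightarrow> (\<exists>C. \<forall>z\<in>space torus. norm (g z) \<le> C) \<Longrightarrow> P g \<Longrightarrow>
                P (\<lambda>z. f z + g z)"
    and lim: "\<And>F f C. (\<And>i::nat. F i \<in> borel_measurable torus) \<Longrightarrow> f \<in> borel_measurable torus \<Longrightarrow>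
                (\<And>i z. z \<in> space torus \<Longrightarrow> norm (F i z) \<le> C) \<Longrightarrow>
                (\<And>z. z \<in> space torus \<Longrightarrow> (\<lambda>i. F i z) \<longlonglongrightarrow> f z) \<Longrightarrow> (\<And>i. P (F i)) \<Longrightarrow> P f"
  shows "P f"
proof -
  \<comment> \<open>Carrying measurability and boundedness along with \<open>P\<close> keeps the
    premises of \<open>cmult\<close>, \<open>add\<close> and \<open>lim\<close> available at each
    stage.\<close>
  define Q where "Q f \<longleftrightarrow> f \<in> borel_measurable torus \<and> (\<exists>C. \<forall>z\<in>space torus. norm (f z) \<le> C) \<and> P f" for f
  have Q_char: "Q (torus_char m)" for m
    unfolding Q_def using char by (auto simp: norm_torus_char intro!: exI[of _ 1])
  have Q_cmult: "Q (\<lambda>z. c * f z)" if "Q f" for c f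
  proof -
    from that obtain C where "\<forall>z\<in>space torus. norm (f z) \<le> C" by (auto simp: Q_def)
    hence "\<forall>z\<in>space torus. norm (c * f z) \<le> norm c * C" by (auto simp: norm_mult intro: mult_left_mono)
    thus ?thesis using that cmult[of f c] unfolding Q_def by auto
  qed
  have Q_add: "Q (\<lambda>z. f z + g z)" if "Q f" "Q g" for f g
  proof -
    from that obtain C D where "\<forall>z\<in>space torus. norm (f z) \<le> C" "\<forall>z\<in>space torus. norm (g z) \<le> D"
      by (auto simp: Q_def)
    hence "\<forall>z\<in>space torus. norm (f z + g z) \<le> C + D"
      by (meson add_mono norm_triangle_ineq order_trans)
    thus ?thesis using that add[of f g] unfolding Q_def by auto
  qed
  have Q_lim: "Q f" if F: "\<And>i::nat. Q (F i)" "\<And>i z. z \<in> space torus \<Longrightarrow> norm (F i z) \<le> C"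
    "\<And>z. z \<in> space torus \<Longrightarrow> (\<lambda>i. F i z) \<longlonglongrightarrow> f z" for F f C
  proof -
    have f: "f \<in> borel_measurable torus"
      by (rule borel_measurable_LIMSEQ_metric[of F]) (use F in \<open>auto simp: Q_def\<close>)
    moreover have "norm (f z) \<le> C" if z: "z \<in> space torus" for z
      by (rule tendsto_upperbound[OF tendsto_norm[OF F(3)[OF z]]])
         (use F(2) z in \<open>auto intro!: always_eventually\<close>)
    moreover have "P f" by (rule lim[of F f C]) (use F f in \<open>auto simp: Q_def\<close>)
    ultimately show ?thesis unfolding Q_def by blast
  qed
  \<comment> \<open>A priori \<open>P\<close> may depend on values off the torus. The constant
    sequence \<open>g\<close> converges on the torus to any function that agrees with
    \<open>g\<close> there, so \<open>lim\<close> removes this dependence.\<close>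
  have Q_cong: "Q f" if "Q g" "\<And>z. z \<in> space torus \<Longrightarrow> f z = g z" for f g
  proof -
    from that obtain C where "\<forall>z\<in>space torus. norm (g z) \<le> C" by (auto simp: Q_def)
    thus ?thesis by (intro Q_lim[of "\<lambda>_. g" C f]) (use that in auto)
  qed
  have Q_trig: "Q p" if "trig_poly p" for p
    using that by (induction rule: trig_poly.induct) (auto intro: Q_char Q_cmult Q_add)
  have Q_cont: "Q (\<lambda>z. of_real (g z))" if g: "continuous_on (space torus) g" for g
  proof -
    have "\<exists>p. trig_poly p \<and> (\<forall>z\<in>space torus. norm (of_real (g z) - p z) < inverse (real (Suc i)))" for i
      by (rule trig_poly_dense[OF g]) simp
    then obtain p where p: "\<And>i. trig_poly (p i)"
      "\<And>i z. z \<in> space torus \<Longrightarrow> norm (of_real (g z) - p i z) < inverse (real (Suc i))" by metis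
    have "bounded (g ` space torus)"
      by (intro compact_imp_bounded compact_continuous_image g compact_space_torus)
    then obtain B where B: "\<And>z. z \<in> space torus \<Longrightarrow> \<bar>g z\<bar> \<le> B" by (auto simp: bounded_iff)
    show ?thesis
    proof (rule Q_lim[of p "B + 1"])
      show "Q (p i)" for i using p by (auto intro: Q_trig)
      fix z :: "'n \<Rightarrow> complex" assume z: "z \<in> space torus"
      show "norm (p i z) \<le> B + 1" for i
      proof -
        have "norm (p i z) \<le> norm (of_real (g z) :: complex) + norm (of_real (g z) - p i z)"
          by norm
        moreover have "inverse (real (Suc i)) \<le> 1" by (simp add: field_simps)
        ultimately show ?thesis using B[OF z] p(2)[OF z, of i] by simp
      qed
      have "(\<lambda>i. of_real (g z) - p i z) \<longlonglongrightarrow> 0"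
        by (rule Lim_null_comparison[OF _ LIMSEQ_inverse_real_of_nat])
           (use p(2)[OF z] in \<open>auto intro!: always_eventually less_imp_le\<close>)
      from tendsto_diff[OF tendsto_const this, of "of_real (g z)"]
      show "(\<lambda>i. p i z) \<longlonglongrightarrow> of_real (g z)" by simp
    qed
  qed
  have Q_zero: "Q (\<lambda>_. 0)" using Q_cmult[OF Q_char, of 0] by simp
  have Q_one: "Q (\<lambda>_. 1)" by (rule Q_cong[OF Q_char[of "\<lambda>_. 0"]]) simp
  have Q_sum: "Q (\<lambda>z. \<Sum>x\<in>X. h x z)" if "finite X" "\<And>x. x \<in> X \<Longrightarrow> Q (h x)" for h and X :: "'b set"
    using that by (induction X rule: finite_induct) (auto intro: Q_zero Q_add)
  have Q_borel: "Q (indicator B)" if "B \<in> sets borel" for B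
  proof -
    \<comment> \<open>Closed sets generate the Borel sets and are stable under intersection, so
      complements and disjoint unions suffice to reach every Borel set.\<close>
    have "Int_stable (Collect closed :: ('n \<Rightarrow> complex) set set)" by (auto simp: Int_stable_def)
    moreover have "Collect closed \<subseteq> Pow UNIV" by simp
    moreover have "B \<in> sigma_sets UNIV (Collect closed)"
      using that by (simp add: borel_eq_closed)
    ultimately show ?thesis
    proof (induction rule: sigma_sets_induct_disjoint)
      case (basic K)
      show ?case
      \<comment> \<open>The distance to the empty set is 0 by convention, so the approximating
        functions would tend to 1 instead of 0 there.\<close>
      proof (cases "K = {}")
        case False
        show ?thesis
        \<comment> \<open>On \<open>K\<close> these functions are constantly 1; off the closed set
          \<open>K\<close> the distance is positive and they are eventually 0.\<close>
        proof (rule Q_lim[where F = "\<lambda>i z. of_real (max 0 (1 - real i * infdist z K))" and C = 1])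
          show "Q (\<lambda>z. of_real (max 0 (1 - real i * infdist z K)))" for i
            by (intro Q_cont continuous_intros)
          show "norm (of_real (max 0 (1 - real i * infdist z K)) :: complex) \<le> 1" for i z
            by (simp only: norm_of_real) (use infdist_nonneg[of z K] in auto)
          fix z :: "'n \<Rightarrow> complex"
          show "(\<lambda>i. of_real (max 0 (1 - real i * infdist z K))) \<longlonglongrightarrow> (indicator K z :: complex)"
          proof (cases "z \<in> K")
            case False
            with basic \<open>K \<noteq> {}\<close> have pos: "infdist z K > 0" by (simp add: infdist_pos_not_in_closed)
            obtain N where N: "1 < real N * infdist z K" using ex_less_of_nat_mult[OF pos] by blast
            have "eventually (\<lambda>i. of_real (max 0 (1 - real i * infdist z K)) = (0::complex)) sequentially"
              using eventually_ge_at_top[of N]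
            proof eventually_elim
              case (elim i)
              hence "real N * infdist z K \<le> real i * infdist z K" using pos by (intro mult_right_mono) auto
              with N show ?case by simp
            qed
            thus ?thesis using False by (simp add: tendsto_eventually)
          qed simp
        qed
      qed (simp add: indicator_def Q_zero)
    next
      case empty
      show ?case by (simp add: indicator_def Q_zero)
    next
      case (compl A)
      have "Q (\<lambda>z. 1 + (-1) * indicator A z)" by (intro Q_add Q_one Q_cmult compl)
      thus ?case by (rule Q_cong) (simp add: indicator_def)
    next
      case (union A)
      have *: "(\<Sum>j<i. indicator (A j) z) = (indicator (\<Union>j<i. A j) z :: complex)" for i z
        using union(1) by (subst indicator_UN_disjoint) (auto simp: disjoint_family_on_def)
      show ?case
      proof (rule Q_lim[where F = "\<lambda>i z. \<Sum>j<i. indicator (A j) z" and C = 1])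
        show "Q (\<lambda>z. \<Sum>j<i. indicator (A j) z)" for i by (intro Q_sum union) auto
        show "norm (\<Sum>j<i. indicator (A j) z :: complex) \<le> 1" for i z
          unfolding * by (simp add: indicator_def)
        show "(\<lambda>i. \<Sum>j<i. indicator (A j) z) \<longlonglongrightarrow> (indicator (\<Union> (range A)) z :: complex)" for z
          unfolding * by (rule LIMSEQ_indicator_UN)
      qed
    qed
  qed
  have Q_sets: "Q (indicator A)" if A: "A \<in> sets torus" for A
  proof -
    from sets_torus_borel_vimage[OF A] obtain B where B: "B \<in> sets borel" "A = B \<inter> space torus" by blast
    from Q_borel[OF B(1)] show ?thesis by (rule Q_cong) (auto simp: B indicator_def)
  qed
  have Q_simple: "Q s" if s: "simple_function torus s" for s
  proof -
    have "Q (\<lambda>z. \<Sum>y\<in>s ` space torus. y * indicator (s -` {y} \<inter> space torus) z)"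
      by (intro Q_sum Q_cmult Q_sets) (use s in \<open>auto simp: simple_function_def\<close>)
    thus ?thesis
    proof (rule Q_cong)
      fix z :: "'n \<Rightarrow> complex" assume z: "z \<in> space torus"
      have "(\<Sum>y\<in>s ` space torus. y * indicator (s -` {y} \<inter> space torus) z) =
            (\<Sum>y\<in>s ` space torus. if y = s z then y else 0)"
        using z by (intro sum.cong) (auto simp: indicator_def)
      also have "\<dots> = s z" using s z by (simp add: simple_function_def)
      finally show "s z = (\<Sum>y\<in>s ` space torus. y * indicator (s -` {y} \<inter> space torus) z)" ..
    qed
  qed
  \<comment> \<open>Centred at 0, the simple approximations obey \<open>2 * norm (f z)\<close>,
    whence the uniform bound \<open>2 * C\<close>.\<close>
  from borel_measurable_implies_sequence_metric[OF f(1), of 0, unfolded dist_norm diff_0_right] obtain F where F: 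
    "\<And>i. simple_function torus (F i)" "\<And>z. z \<in> space torus \<Longrightarrow> (\<lambda>i. F i z) \<longlonglongrightarrow> f z"
    "\<And>i z. z \<in> space torus \<Longrightarrow> norm (F i z) \<le> 2 * norm (f z)" by blast
  obtain C where C: "\<And>z. z \<in> space torus \<Longrightarrow> norm (f z) \<le> C" using f(2) by blast
  have "Q f"
  proof (rule Q_lim[of F "2 * C"])
    show "norm (F i z) \<le> 2 * C" if "z \<in> space torus" for i z
      using F(3)[OF that, of i] C[OF that] by linarith
  qed (use F Q_simple in auto)
  thus ?thesis by (simp add: Q_def)
qed

subsection \<open>Measure-preserving maps of the torus\<close>

lemma integral_circle_powi: "(\<integral>z. z powi a \<partial>circle) = (if a = 0 then 1 else 0)"
proof -
  have [measurable]: "(\<lambda>z. z powi a) \<in> borel_measurable (borel :: complex measure)"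
    unfolding power_int_def by measurable
  have meas: "(\<lambda>t. cis (2 * pi * t)) \<in> uniform_measure lborel {0..1} \<rightarrow>\<^sub>M restrict_space borel (sphere 0 1)"
  proof (rule measurable_restrict_space2)
    have "(\<lambda>t::real. cis (2 * pi * t)) \<in> borel_measurable borel"
      by (intro borel_measurable_continuous_onI continuous_intros)
    thus "(\<lambda>t. cis (2 * pi * t)) \<in> borel_measurable (uniform_measure lborel {0..1})"
      by (simp add: measurable_def)
  qed auto
  have "(\<integral>z. z powi a \<partial>circle) = (\<integral>t. cis (2 * pi * t) powi a \<partial>uniform_measure lborel {0..1})"
    unfolding circle_def
    by (intro integral_distr meas) (rule measurable_restrict_space1, measurable)
  also have "\<dots> = (\<integral>t. indicator {0..1} t *\<^sub>R cis (2 * pi * a * t) \<partial>lborel)"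
  proof -
    have "(\<lambda>t. cis (2 * pi * t) powi a) \<in> borel_measurable lborel"
      using meas by (simp add: cis_power_int) (intro borel_measurable_continuous_onI continuous_intros)
    moreover have "uniform_measure lborel {0..1} = density lborel (\<lambda>t::real. ennreal (indicator {0..1} t))"
      by (simp add: uniform_measure_def ennreal_indicator divide_ennreal_def)
    ultimately have "(\<integral>t. cis (2 * pi * t) powi a \<partial>uniform_measure lborel {0..1}) =
      (\<integral>t. indicator {0..1} t *\<^sub>R cis (2 * pi * t) powi a \<partial>lborel)"
      by (simp add: integral_density)
    thus ?thesis by (simp add: cis_power_int mult_ac)
  qed
  also have "\<dots> = (if a = 0 then 1 else 0)"
  proof (cases "a = 0")
    case False
    \<comment> \<open>With this \<open>c\<close> the integrand is
      \<open>exp (c * of_real t)\<close>; its antiderivative takes equal values at 0 and 1 because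
      \<open>a\<close> is an integer.\<close>
    define c :: complex where "c = \<i> * of_real (2 * pi * a)"
    have c: "c \<noteq> 0" using False by (simp add: c_def)
    have cis: "cis (2 * pi * a * t) = exp (c * of_real t)" for t
      by (simp add: cis_conv_exp c_def mult_ac)
    have "((\<lambda>t. exp (c * of_real t) / c) has_vector_derivative exp (c * of_real t)) (at t within {0..1})" for t
      by (rule has_vector_derivative_real_field) (use c in \<open>auto intro!: derivative_eq_intros\<close>)
    hence "(\<integral>t. indicator {0..1} t *\<^sub>R exp (c * of_real t) \<partial>lborel) =
             exp (c * of_real 1) / c - exp (c * of_real 0) / c"
      by (intro integral_FTC_Icc continuous_intros) auto
    also have "exp (c * of_real 1) = 1"
      unfolding cis[symmetric] using cis_multiple_2pi[of "of_int a"] by (simp add: mult_ac)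
    finally show ?thesis using False by (simp add: cis)
  qed simp
  finally show ?thesis .
qed

lemma integral_torus_char:
  "(\<integral>z. torus_char m z \<partial>torus) = (if m = (\<lambda>_::'n::finite. 0) then 1 else 0)"
proof -
  interpret prob_space circle by (rule prob_space_circle)
  interpret product_sigma_finite "\<lambda>_::'n. circle" by standard
  have "(\<lambda>z::complex. z powi a) \<in> borel_measurable circle" for a
    unfolding measurable_cong_sets[OF sets_circle refl] power_int_def
    by (rule measurable_restrict_space1) measurable
  hence "integrable circle (\<lambda>z. z powi a)" for a
    by (intro integrable_const_bound[where B = 1]) (auto simp: norm_power_int)
  hence "(\<integral>z. torus_char m z \<partial>torus) = (\<Prod>i\<in>UNIV. \<integral>z. z powi m i \<partial>circle)"
    unfolding torus_def torus_char_def by (intro product_integral_prod) auto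
  also have "\<dots> = (\<Prod>i\<in>UNIV. if m i = 0 then 1 else 0)"
    by (simp add: integral_circle_powi)
  also have "\<dots> = (if m = (\<lambda>_. 0) then 1 else 0)" by (auto simp: fun_eq_iff)
  finally show ?thesis .
qed

section \<open>Invariance of Haar measure tested on characters\<close>

lemma integrable_torus_bounded:
  fixes f :: "('n::finite \<Rightarrow> complex) \<Rightarrow> 'b::{banach, second_countable_topology}"
  assumes "f \<in> borel_measurable torus" "\<And>z. z \<in> space torus \<Longrightarrow> norm (f z) \<le> C"
  shows "integrable torus f"
proof -
  interpret prob_space "torus :: ('n \<Rightarrow> complex) measure" by (rule prob_space_torus)
  show ?thesis by (rule integrable_const_bound[where B = C]) (use assms in auto)
qed

text \<open>For the trivial character both integrals are 1, for the others both are 0. The monotone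
  class induction carries this equality to all bounded measurable functions, in particular to
  indicators.\<close>

lemma distr_torus_eqI:
  fixes \<sigma> :: "('n::finite \<Rightarrow> complex) \<Rightarrow> 'n \<Rightarrow> complex"
  assumes \<sigma> [measurable]: "\<sigma> \<in> torus \<rightarrow>\<^sub>M torus"
    and nontrivial: "\<And>m. m \<noteq> (\<lambda>_. 0) \<Longrightarrow> (\<integral>z. torus_char m (\<sigma> z) \<partial>torus) = 0"
  shows "distr torus torus \<sigma> = torus"
proof (rule measure_eqI)
  interpret T: prob_space "torus :: ('n \<Rightarrow> complex) measure" by (rule prob_space_torus)
  interpret D: prob_space "distr torus torus \<sigma>" by (rule T.prob_space_distr) (rule \<sigma>)
  note space = measurable_space[OF \<sigma>]
  have eq: "(\<integral>z. f (\<sigma> z) \<partial>torus) = (\<integral>z. f z \<partial>torus)"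
    if f: "f \<in> borel_measurable torus" "\<exists>C. \<forall>z\<in>space torus. norm (f z) \<le> C"
    for f :: "('n \<Rightarrow> complex) \<Rightarrow> complex"
    using f
  proof (induction f rule: torus_bounded_measurable_induct)
    case (char m)
    show ?case
      by (cases "m = (\<lambda>_. 0)")
         (auto simp: nontrivial integral_torus_char T.prob_space D.prob_space torus_char_0[abs_def])
  next
    case (cmult c f)
    thus ?case by simp
  next
    case (add f g)
    have int: "integrable torus h" "integrable torus (\<lambda>z. h (\<sigma> z))"
      if h: "h \<in> borel_measurable torus" "\<exists>C. \<forall>z\<in>space torus. norm (h z) \<le> C"
      for h :: "('n \<Rightarrow> complex) \<Rightarrow> complex"
      using h(2) measurable_compose[OF \<sigma> h(1)] by (auto intro!: integrable_torus_bounded h(1) space)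
    have "integrable torus f" "integrable torus g"
      "integrable torus (\<lambda>z. f (\<sigma> z))" "integrable torus (\<lambda>z. g (\<sigma> z))"
      using add by (auto intro!: int)
    with add show ?case by simp
  next
    case (lim F f C)
    note [measurable] = lim(1,2)
    have "(\<lambda>i. \<integral>z. F i (\<sigma> z) \<partial>torus) \<longlonglongrightarrow> (\<integral>z. f (\<sigma> z) \<partial>torus)"
      by (rule integral_dominated_convergence[where w = "\<lambda>_. C"]) (use lim space in auto)
    moreover have "(\<lambda>i. \<integral>z. F i z \<partial>torus) \<longlonglongrightarrow> (\<integral>z. f z \<partial>torus)"
      by (rule integral_dominated_convergence[where w = "\<lambda>_. C"]) (use lim in auto)
    ultimately show ?case using lim(5) LIMSEQ_unique by simp
  qed
  fix A assume "A \<in> sets (distr torus torus \<sigma>)"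
  hence A [measurable]: "A \<in> sets torus" by simp
  have "(\<integral>z. complex_of_real (indicator A z) \<partial>distr torus torus \<sigma>) =
          (\<integral>z. complex_of_real (indicator A (\<sigma> z)) \<partial>torus)"
    by (rule integral_distr) measurable
  also have "\<dots> = (\<integral>z. complex_of_real (indicator A z) \<partial>torus)"
    by (rule eq) (auto simp: indicator_def)
  finally have "measure (distr torus torus \<sigma>) A = measure torus A"
    by (simp only: integral_complex_of_real of_real_eq_iff) simp
  thus "emeasure (distr torus torus \<sigma>) A = emeasure torus A"
    by (simp add: T.emeasure_eq_measure D.emeasure_eq_measure)
qed simp

text \<open>Rotation by \<open>w\<close> multiplies a character by the constant
  \<open>torus_char m w\<close>, so vanishing integrals still vanish.\<close>

lemma distr_torus_rotate:
  fixes w :: "'n::finite \<Rightarrow> complex"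
  assumes w: "w \<in> space torus"
  shows "(\<lambda>z i. w i * z i) \<in> torus \<rightarrow>\<^sub>M torus" "distr torus torus (\<lambda>z i. w i * z i) = torus"
proof -
  show 1: "(\<lambda>z i. w i * z i) \<in> torus \<rightarrow>\<^sub>M torus"
    by (rule measurable_torusI) (auto simp: norm_mult norm_torus w)
  have "torus_char m (\<lambda>i. w i * z i) = torus_char m w * torus_char m z" for m z
    by (simp add: torus_char_def power_int_mult_distrib prod.distrib)
  thus "distr torus torus (\<lambda>z i. w i * z i) = torus"
    by (intro distr_torus_eqI 1) (simp add: integral_torus_char)
qed

text \<open>Composition turns the character of index m into that of index -km, which is nontrivial
  whenever m is, as \<open>k > 0\<close>.\<close>

lemma distr_torus_inverse_power:
  assumes "k > 0"
  shows "(\<lambda>z i. inverse (z i ^ k)) \<in> torus \<rightarrow>\<^sub>M (torus :: ('n::finite \<Rightarrow> complex) measure)"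
    "distr torus torus (\<lambda>z i. inverse (z i ^ k)) = (torus :: ('n \<Rightarrow> complex) measure)"
proof -
  show 1: "(\<lambda>z i. inverse (z i ^ k)) \<in> torus \<rightarrow>\<^sub>M (torus :: ('n::finite \<Rightarrow> complex) measure)"
    by (rule measurable_torusI) (auto simp: norm_inverse norm_power norm_torus)
  have *: "torus_char m (\<lambda>i. inverse (z i ^ k)) = torus_char (\<lambda>i. - (int k * m i)) z"
    for m and z :: "'n \<Rightarrow> complex"
    by (simp add: torus_char_def power_int_mult power_int_minus power_int_inverse)
  show "distr torus torus (\<lambda>z i. inverse (z i ^ k)) = (torus :: ('n \<Rightarrow> complex) measure)"
    by (intro distr_torus_eqI 1) (use assms in \<open>auto simp: * integral_torus_char fun_eq_iff\<close>)
qed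

subsection \<open>Density of the monomials in \<open>L\<^sup>2\<close>\<close>

lemma torus_L2_cases:
  obtains f where "square_integrable f" "x = abs_torus_L2 f"
proof -
  have "L2_rel (rep_torus_L2 x) (rep_torus_L2 x)"
    by (rule Quotient_rep_reflp[OF Quotient_torus_L2])
  moreover have "x = abs_torus_L2 (rep_torus_L2 x)"
    by (simp add: Quotient_abs_rep[OF Quotient_torus_L2])
  ultimately show ?thesis using that by (auto simp: L2_rel_def)
qed

lemma L2_rel_refl: "L2_rel f f \<longleftrightarrow> square_integrable f"
  by (auto simp: L2_rel_def)

lemma monomial_eq: "monomial m = abs_torus_L2 (torus_char m)"
  by (simp add: monomial.abs_eq torus_char_def[abs_def])

lemma square_integrable_bounded:
  assumes f: "f \<in> borel_measurable torus" "\<And>z. z \<in> space torus \<Longrightarrow> norm (f z) \<le> C"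
  shows "square_integrable f"
  unfolding square_integrable_def
proof (safe intro!: integrable_torus_bounded)
  have [measurable]: "f \<in> borel_measurable torus" by (rule f)
  show "(\<lambda>z. (norm (f z))\<^sup>2) \<in> borel_measurable torus" by measurable
  fix z :: "'a \<Rightarrow> complex" assume "z \<in> space torus"
  thus "norm ((norm (f z))\<^sup>2) \<le> C\<^sup>2" using f(2)[of z] by (auto intro: power_mono)
qed (rule f)

lemma square_integrable_char: "square_integrable (torus_char m)"
  by (rule square_integrable_bounded[where C = 1]) (auto simp: norm_torus_char)

lemma plus_abs_L2:
  "square_integrable f \<Longrightarrow> square_integrable g \<Longrightarrow>
     abs_torus_L2 f + abs_torus_L2 g = abs_torus_L2 (\<lambda>z. f z + g z)"
  by (simp add: plus_torus_L2.abs_eq L2_rel_refl)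

lemma scaleC_abs_L2: "square_integrable f \<Longrightarrow> c *\<^sub>C abs_torus_L2 f = abs_torus_L2 (\<lambda>z. c * f z)"
  by (simp add: scaleC_L2.abs_eq L2_rel_refl)

lemma square_integrable_diff:
  "square_integrable f \<Longrightarrow> square_integrable g \<Longrightarrow> square_integrable (\<lambda>z. f z - g z)"
  using square_integrable_add[OF _ square_integrable_cmult, of f g "-1"] by simp

lemma minus_abs_L2:
  assumes "square_integrable f" "square_integrable g"
  shows "abs_torus_L2 f - abs_torus_L2 g = abs_torus_L2 (\<lambda>z. f z - g z)"
  using assms square_integrable_cmult[of g "-1"]
  by (simp add: minus_torus_L2_def uminus_torus_L2_def scaleC_abs_L2 plus_abs_L2)

lemma inner_abs_L2:
  "square_integrable f \<Longrightarrow> square_integrable g \<Longrightarrow>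
     inner (abs_torus_L2 f) (abs_torus_L2 g) = Re (\<integral>z. f z * cnj (g z) \<partial>torus)"
  by (simp add: inner_torus_L2.abs_eq L2_rel_refl)

lemma norm_abs_L2: 
  assumes "square_integrable f"
  shows "(norm (abs_torus_L2 f))\<^sup>2 = (\<integral>z. (norm (f z))\<^sup>2 \<partial>torus)"
proof -
  have "(norm (abs_torus_L2 f))\<^sup>2 = Re (\<integral>z. f z * cnj (f z) \<partial>torus)"
    using assms by (simp add: power2_norm_eq_inner inner_abs_L2)
  also have "\<dots> = (\<integral>z. (norm (f z))\<^sup>2 \<partial>torus)"
    by (simp only: complex_norm_square[symmetric] integral_complex_of_real Re_complex_of_real)
  finally show ?thesis .
qed

text \<open>Dominated convergence for the squared distances, with \<open>G\<close> as dominating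
  function.\<close>

lemma tendsto_abs_L2:
  fixes f :: "('n::finite \<Rightarrow> complex) \<Rightarrow> complex"
  assumes F: "\<And>i::nat. square_integrable (F i)" and f: "square_integrable f"
    and G: "integrable torus G" "\<And>i z. z \<in> space torus \<Longrightarrow> (norm (F i z - f z))\<^sup>2 \<le> G z"
    and lim: "\<And>z. z \<in> space torus \<Longrightarrow> (\<lambda>i. F i z) \<longlonglongrightarrow> f z"
  shows "(\<lambda>i. abs_torus_L2 (F i)) \<longlonglongrightarrow> abs_torus_L2 f"
proof -
  have [measurable]: "F i \<in> borel_measurable torus" "f \<in> borel_measurable torus" for i
    using F f by (auto simp: square_integrable_def)
  have "(\<lambda>i. \<integral>z. (norm (F i z - f z))\<^sup>2 \<partial>torus) \<longlonglongrightarrow> (\<integral>z. 0 \<partial>(torus :: ('n \<Rightarrow> complex) measure))"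
  proof (rule integral_dominated_convergence[where w = G])
    have "(\<lambda>i. (norm (F i z - f z))\<^sup>2) \<longlonglongrightarrow> 0" if "z \<in> space torus" for z
      using tendsto_power[OF tendsto_norm[OF tendsto_diff[OF lim[OF that] tendsto_const]], of "f z" 2] by simp
    thus "AE z in torus. (\<lambda>i. (norm (F i z - f z))\<^sup>2) \<longlonglongrightarrow> 0" by simp
  qed (use G in auto)
  also have "(\<lambda>i. \<integral>z. (norm (F i z - f z))\<^sup>2 \<partial>torus) = (\<lambda>i. (norm (abs_torus_L2 (F i) - abs_torus_L2 f))\<^sup>2)"
    by (simp add: minus_abs_L2 norm_abs_L2 square_integrable_diff F f)
  finally have "(\<lambda>i. (norm (abs_torus_L2 (F i) - abs_torus_L2 f))\<^sup>2) \<longlonglongrightarrow> 0" by simp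
  hence "(\<lambda>i. norm (abs_torus_L2 (F i) - abs_torus_L2 f)) \<longlonglongrightarrow> 0"
    using tendsto_real_sqrt by fastforce
  from LIM_zero_cancel[OF tendsto_norm_zero_cancel[OF this]] show ?thesis .
qed

text \<open>Bounded pointwise limits are norm limits, so the monotone class induction covers all
  bounded functions; truncation covers the rest. Totality of the monomials is used in this
  form.\<close>

theorem torus_L2_induct [case_names monomial scaleC add closed]:
  fixes x :: "'n::finite torus_L2"
  assumes monomial: "\<And>m. Q (monomial m)"
    and scaleC: "\<And>c x. Q x \<Longrightarrow> Q (c *\<^sub>C x)"
    and add: "\<And>x y. Q x \<Longrightarrow> Q y \<Longrightarrow> Q (x + y)"
    and closed: "closed {x. Q x}"
  shows "Q x"
proof -
  have Q_lim: "Q y" if "\<And>i. Q (X i)" "X \<longlonglongrightarrow> y" for X y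
    using closed_sequentially[OF closed, of X y] that by simp
  have bounded: "Q (abs_torus_L2 f)"
    if "f \<in> borel_measurable torus" "\<exists>C. \<forall>z\<in>space torus. norm (f z) \<le> C" 
    for f :: "('n \<Rightarrow> complex) \<Rightarrow> complex"
    using that
  proof (induction f rule: torus_bounded_measurable_induct)
    case (char m)
    show ?case using monomial[of m] by (simp add: monomial_eq)
  next
    case (cmult c f)
    hence "square_integrable f" by (auto intro: square_integrable_bounded)
    thus ?case using scaleC[OF cmult(3), of c] by (simp add: scaleC_abs_L2)
  next
    case (add f g)
    hence "square_integrable f" "square_integrable g" by (auto intro: square_integrable_bounded)
    thus ?case using assms(3)[OF add.IH] by (simp add: plus_abs_L2)
  next
    case (lim F f C)
    have f_le: "norm (f z) \<le> C" if z: "z \<in> space torus" for z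
      by (rule tendsto_upperbound[OF tendsto_norm[OF lim(4)[OF z]]])
         (use lim(3)[OF z] in \<open>auto intro!: always_eventually\<close>)
    show ?case
    proof (rule Q_lim[of "\<lambda>i. abs_torus_L2 (F i)", OF lim.IH tendsto_abs_L2])
      show "square_integrable (F i)" for i using lim by (intro square_integrable_bounded[of _ C]) auto
      show "square_integrable f" using lim f_le by (intro square_integrable_bounded[of _ C]) auto
      show "integrable torus (\<lambda>_::'n \<Rightarrow> complex. (2 * C)\<^sup>2)"
        by (rule integrable_torus_bounded) auto
      show "(norm (F i z - f z))\<^sup>2 \<le> (2 * C)\<^sup>2" if z: "z \<in> space torus" for i z
        using norm_triangle_ineq4[of "F i z" "f z"] lim(3)[OF z, of i] f_le[OF z] by (intro power_mono) auto
    qed (use lim in auto)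
  qed
  obtain f where f: "square_integrable f" and x: "x = abs_torus_L2 f" by (rule torus_L2_cases)
  have [measurable]: "f \<in> borel_measurable torus" and int: "integrable torus (\<lambda>z. (norm (f z))\<^sup>2)"
    using f by (auto simp: square_integrable_def)
  \<comment> \<open>Replacing \<open>f\<close> by 0 where its modulus exceeds \<open>i\<close>
    leaves an error whose square is dominated by the integrable square of \<open>f\<close>.\<close>
  define F where "F i z = (if norm (f z) \<le> real i then f z else 0)" for i :: nat and z
  have F_bounded: "norm (F i z) \<le> real i" for i z by (simp add: F_def)
  have F_meas: "F i \<in> borel_measurable torus" for i unfolding F_def by measurable
  show ?thesis unfolding x
  proof (rule Q_lim[of "\<lambda>i. abs_torus_L2 (F i)"])
    show "Q (abs_torus_L2 (F i))" for i using F_bounded by (intro bounded F_meas) blast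
    show "(\<lambda>i. abs_torus_L2 (F i)) \<longlonglongrightarrow> abs_torus_L2 f"
    proof (rule tendsto_abs_L2[OF _ f int])
      show "square_integrable (F i)" for i
        using F_meas F_bounded by (rule square_integrable_bounded)
      show "(norm (F i z - f z))\<^sup>2 \<le> (norm (f z))\<^sup>2" for i z by (simp add: F_def)
      fix z
      have "eventually (\<lambda>i. F i z = f z) sequentially"
        using eventually_ge_at_top[of "nat \<lceil>norm (f z)\<rceil>"]
        by eventually_elim (auto simp: F_def ceiling_le_iff nat_le_iff)
      thus "(\<lambda>i. F i z) \<longlonglongrightarrow> f z" by (rule tendsto_eventually)
    qed
  qed
qed

text \<open>\<open>inner\<close> is only the real part of the Hermitian product; letting a scalar \<open>c\<close> range over
  the complex numbers on one side recovers the whole of it.\<close>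

lemma inner_monomial:
  "inner (monomial m) (c *\<^sub>C monomial l) = (if m = l then Re c else 0)"
proof -
  have "inner (monomial m) (c *\<^sub>C monomial l) = Re (\<integral>z. torus_char m z * cnj (c * torus_char l z) \<partial>torus)"
    by (simp add: monomial_eq scaleC_abs_L2 inner_abs_L2 square_integrable_char square_integrable_cmult)
  also have "(\<integral>z. torus_char m z * cnj (c * torus_char l z) \<partial>torus) =
             (\<integral>z. cnj c * torus_char (\<lambda>i. m i - l i) z \<partial>torus)"
    by (intro Bochner_Integration.integral_cong refl)
       (simp add: cnj_torus_char torus_char_add[of _ m "\<lambda>i. - l i", simplified])
  also have "\<dots> = cnj c * (if m = l then 1 else 0)"
    by (auto simp: integral_torus_char fun_eq_iff)
  finally show ?thesis by simp
qed

section \<open>Complex scalars, continuity and totality of the monomials\<close>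

lemma scaleC_scaleC_L2 [simp]: "a *\<^sub>C b *\<^sub>C x = (a * b) *\<^sub>C (x :: 'n::finite torus_L2)"
  by (rule torus_L2_cases[of x]) (simp add: scaleC_abs_L2 square_integrable_cmult mult.assoc)

lemma scaleC_one_L2 [simp]: "1 *\<^sub>C x = (x :: 'n::finite torus_L2)"
  by (rule torus_L2_cases[of x]) (simp add: scaleC_abs_L2)

lemma inner_scaleC_L2: "inner (c *\<^sub>C x) y = inner x (cnj c *\<^sub>C (y :: 'n::finite torus_L2))"
  by (rule torus_L2_cases[of x], rule torus_L2_cases[of y])
     (simp add: scaleC_abs_L2 inner_abs_L2 square_integrable_cmult mult.assoc mult.left_commute)

lemma norm_scaleC_L2: "norm (c *\<^sub>C x) = norm c * norm (x :: 'n::finite torus_L2)"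
proof -
  have "(norm (c *\<^sub>C x))\<^sup>2 = (norm c * norm x)\<^sup>2"
    by (rule torus_L2_cases[of x])
       (simp add: scaleC_abs_L2 norm_abs_L2 square_integrable_cmult norm_mult power_mult_distrib)
  thus ?thesis by (simp add: power2_eq_iff_nonneg)
qed

lemma norm_monomial [simp]: "norm (monomial m) = 1"
  using inner_monomial[of m 1 m] by (simp add: norm_eq_sqrt_inner)

lemma scaleR_L2: "r *\<^sub>R x = complex_of_real r *\<^sub>C (x :: 'n::finite torus_L2)"
  by (simp add: scaleR_torus_L2_def)

lemma bounded_operator_imp_bounded_linear:
  fixes T :: "'n::finite torus_L2 \<Rightarrow> 'n torus_L2"
  assumes "bounded_operator T"
  shows "bounded_linear T"
proof -
  from assms obtain C where "\<forall>f. norm (T f) \<le> C * norm f" by (auto simp: bounded_operator_def)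
  thus ?thesis using assms unfolding bounded_operator_def complex_linear_def
    by (intro bounded_linear_intro[where K = C]) (auto simp: scaleR_L2 mult.commute)
qed

lemma scaleC_add_L2: "c *\<^sub>C (x + y) = c *\<^sub>C x + c *\<^sub>C (y :: 'n::finite torus_L2)"
  by (rule torus_L2_cases[of x], rule torus_L2_cases[of y])
     (simp add: scaleC_abs_L2 plus_abs_L2 square_integrable_add square_integrable_cmult distrib_left)

lemma continuous_on_scaleC_L2: "continuous_on A (\<lambda>x. c *\<^sub>C (x :: 'n::finite torus_L2))"
proof -
  have "bounded_linear (\<lambda>x. c *\<^sub>C (x :: 'n::finite torus_L2))"
    by (rule bounded_linear_intro[where K = "norm c"])
       (simp_all add: scaleC_add_L2 scaleR_L2 norm_scaleC_L2 mult.commute)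
  thus ?thesis by (rule linear_continuous_on)
qed

text \<open>The set where two continuous maps agree is closed, so \<open>torus_L2_induct\<close>
  applies. This is the uniqueness behind the definite description in \<open>V_op\<close>.\<close>

lemma bounded_operator_eqI:
  assumes "bounded_operator S" "bounded_operator T" "\<And>m. S (monomial m) = T (monomial m)"
  shows "S = T"
proof
  fix x
  show "S x = T x"
  proof (induction x rule: torus_L2_induct)
    case closed
    show ?case
      by (intro closed_Collect_eq linear_continuous_on bounded_operator_imp_bounded_linear assms)
  qed (use assms in \<open>auto simp: bounded_operator_def complex_linear_def\<close>)
qed

text \<open>Orthogonality to \<open>x\<close> passes to closed linear spans, so \<open>x\<close> is
  orthogonal to itself.\<close>

lemma inner_zero_monomials:
  assumes "\<And>c m. inner x (c *\<^sub>C monomial m) = 0"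
  shows "x = 0"
proof -
  \<comment> \<open>All scalars stay in the induction claim, so that the \<open>scaleC\<close> case
    can absorb its factor into \<open>c\<close>.\<close>
  have "\<forall>c. inner x (c *\<^sub>C y) = 0" for y
  proof (induction y rule: torus_L2_induct)
    case (add y z)
    thus ?case by (simp add: scaleC_add_L2 inner_add_right)
  next
    case closed
    have "closed (\<Inter>c. {y. inner x (c *\<^sub>C y) = 0})"
      by (intro closed_INT ballI closed_Collect_eq continuous_intros continuous_on_scaleC_L2)
    thus ?case by (simp add: Collect_all_eq)
  qed (use assms in auto)
  from this[of x] have "inner x (1 *\<^sub>C x) = 0" by blast
  thus ?thesis by simp
qed

subsection \<open>Existence and uniqueness of \<open>V_op\<close>\<close>

definition torsion :: "nat \<Rightarrow> ('n::finite \<Rightarrow> complex) set" where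
  "torsion k = {w. \<forall>i. w i ^ k = 1}"

text \<open>On the torus, a section of z |-> z^-k. The branch cut of \<open>Ln\<close> spoils
  continuity, but measurability is enough.\<close>

definition root_map :: "nat \<Rightarrow> ('n::finite \<Rightarrow> complex) \<Rightarrow> 'n \<Rightarrow> complex" where
  "root_map k z i = exp (- Ln (z i) / of_nat k)"

text \<open>For \<open>z\<close> on the torus and \<open>k > 0\<close> the arguments of
  \<open>f\<close> run through all u with u^-k = z, so the average does not depend on the branch of
  the root.\<close>

definition fibre_average :: "nat \<Rightarrow> (('n::finite \<Rightarrow> complex) \<Rightarrow> complex) \<Rightarrow> ('n \<Rightarrow> complex) \<Rightarrow> complex" where
  "fibre_average k f z = (\<Sum>w\<in>torsion k. f (\<lambda>i. w i * root_map k z i)) / of_nat (card (torsion k :: ('n \<Rightarrow> complex) set))"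

lemma norm_eq_1_if_power: "k > 0 \<Longrightarrow> norm (w ^ k) = 1 \<Longrightarrow> norm (w :: complex) = 1"
  using power_eq_imp_eq_base[of "norm w" k 1] by (simp add: norm_power)

lemma torsion_subset_torus: "k > 0 \<Longrightarrow> w \<in> torsion k \<Longrightarrow> w \<in> space torus"
  unfolding in_space_torus_iff by (rule allI, rule norm_eq_1_if_power) (auto simp: torsion_def)

lemma finite_torsion:
  assumes "k > 0"
  shows "finite (torsion k :: ('n::finite \<Rightarrow> complex) set)"
proof -
  have "finite {z::complex. z ^ k = 1}" using assms by (intro finite_roots_unity) auto
  hence "finite ((UNIV :: 'n set) \<rightarrow>\<^sub>E {z::complex. z ^ k = 1})" by (intro finite_PiE) auto
  also have "(UNIV :: 'n set) \<rightarrow>\<^sub>E {z::complex. z ^ k = 1} = torsion k"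
    by (auto simp: torsion_def PiE_def Pi_def)
  finally show ?thesis .
qed

lemma card_torsion_pos: "k > 0 \<Longrightarrow> card (torsion k :: ('n::finite \<Rightarrow> complex) set) > 0"
proof -
  assume "k > 0"
  moreover have "(\<lambda>_. 1) \<in> (torsion k :: ('n \<Rightarrow> complex) set)" by (simp add: torsion_def)
  ultimately show ?thesis using finite_torsion card_gt_0_iff by blast
qed

lemma sum_torsion_translate:
  assumes "u \<in> torsion k" "k > 0"
  shows "(\<Sum>w\<in>torsion k. h (\<lambda>i. w i * u i)) = (\<Sum>w\<in>torsion k. h w)"
proof (rule sum.reindex_bij_witness[where i = "\<lambda>w i. w i / u i" and j = "\<lambda>w i. w i * u i"])
  have "u i \<noteq> 0" for i
  proof
    assume "u i = 0"
    moreover have "u i ^ k = 1" using assms(1) by (simp add: torsion_def)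
    ultimately show False using assms(2) by (simp add: power_0_left)
  qed
  thus "(\<lambda>i. w i * u i / u i) = w" "(\<lambda>i. w i / u i * u i) = w" for w by auto
qed (use assms in \<open>auto simp: torsion_def power_mult_distrib power_divide\<close>)

lemma root_map_power:
  assumes "k > 0" "z \<in> space torus"
  shows "root_map k z i ^ k = inverse (z i)"
proof -
  have "root_map k z i ^ k = exp (of_nat k * (- Ln (z i) / of_nat k))"
    unfolding root_map_def by (rule exp_of_nat_mult[symmetric])
  also have "of_nat k * (- Ln (z i) / of_nat k) = - Ln (z i)" using assms by simp
  also have "exp \<dots> = inverse (z i)"
    using assms by (simp add: exp_minus torus_component_nonzero)
  finally show ?thesis .
qed

lemma measurable_root_map:
  assumes "k > 0"
  shows "root_map k \<in> torus \<rightarrow>\<^sub>M torus"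
proof (rule measurable_torusI)
  show "(\<lambda>z. root_map k z i) \<in> borel_measurable torus" for i :: 'a
    unfolding root_map_def by measurable
  show "norm (root_map k z i) = 1" if "z \<in> space torus" for z and i :: 'a
    by (rule norm_eq_1_if_power[OF assms])
       (simp add: root_map_power[OF assms that] norm_inverse norm_torus[OF that])
qed

lemma measurable_torsion_root_map:
  assumes "k > 0" "w \<in> torsion k"
  shows "(\<lambda>z i. w i * root_map k z i) \<in> torus \<rightarrow>\<^sub>M torus"
  using measurable_compose[OF measurable_root_map[OF assms(1)]
    distr_torus_rotate(1)[OF torsion_subset_torus[OF assms]]] .

lemma measurable_fibre_average:
  fixes f :: "('n::finite \<Rightarrow> complex) \<Rightarrow> complex"
  assumes "k > 0" and f: "f \<in> borel_measurable torus"
  shows "fibre_average k f \<in> borel_measurable torus"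
  unfolding fibre_average_def
  by (intro borel_measurable_divide borel_measurable_sum borel_measurable_const
        measurable_compose[OF measurable_torsion_root_map[OF assms(1)] f])

text \<open>Every fibre of \<open>z \<mapsto> z\<^sup>-\<^sup>k\<close> is a coset of the \<open>k\<close>-torsion, and this map preserves
  the measure, as do translations.\<close>

lemma nn_integral_fibre_sum:
  fixes g :: "('n::finite \<Rightarrow> complex) \<Rightarrow> ennreal"
  assumes k: "k > 0" and g [measurable]: "g \<in> borel_measurable torus"
  shows "(\<integral>\<^sup>+z. (\<Sum>w\<in>torsion k. g (\<lambda>i. w i * root_map k z i)) \<partial>torus) =
           of_nat (card (torsion k :: ('n \<Rightarrow> complex) set)) * (\<integral>\<^sup>+z. g z \<partial>torus)"
proof -
  define A where "A z = (\<Sum>w\<in>torsion k. g (\<lambda>i. w i * z i))" for z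
  define \<tau> :: "('n \<Rightarrow> complex) \<Rightarrow> 'n \<Rightarrow> complex" where "\<tau> z i = inverse (z i ^ k)" for z i
  have \<tau>: "\<tau> \<in> torus \<rightarrow>\<^sub>M torus" "distr torus torus \<tau> = torus"
    using distr_torus_inverse_power[OF k] by (simp_all add: \<tau>_def[abs_def])
  have rotate: "(\<lambda>z i. w i * z i) \<in> torus \<rightarrow>\<^sub>M torus" if "w \<in> torsion k" for w :: "'n \<Rightarrow> complex"
    by (rule distr_torus_rotate(1)[OF torsion_subset_torus[OF k that]])
  have g_rotate: "(\<lambda>z. g (\<lambda>i. w i * z i)) \<in> borel_measurable torus" if "w \<in> torsion k" for w
    by (rule measurable_compose[OF rotate[OF that] g])
  have A: "A \<in> borel_measurable torus"
    unfolding A_def by (intro borel_measurable_sum g_rotate)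
  \<comment> \<open>The point \<open>z\<close> and the chosen root of \<open>\<tau> z\<close> lie in
    one fibre of \<open>\<tau>\<close>; their quotient \<open>u\<close> is a torsion point and
    merely permutes the summands of \<open>A\<close>.\<close>
  have A_root: "A (root_map k (\<tau> z)) = A z" if z: "z \<in> space torus" for z
  proof -
    define u where "u i = root_map k (\<tau> z) i / z i" for i
    have \<tau>z: "\<tau> z \<in> space torus" by (rule measurable_space[OF \<tau>(1) z])
    have "u \<in> torsion k"
      using torus_component_nonzero[OF z]
      by (simp add: torsion_def u_def power_divide root_map_power[OF k \<tau>z]) (simp add: \<tau>_def)
    from sum_torsion_translate[OF this k, of "\<lambda>v. g (\<lambda>i. v i * z i)"] show ?thesis
      using torus_component_nonzero[OF z] by (simp add: A_def u_def)
  qed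
  \<comment> \<open>Replacing Haar measure by its image under \<open>\<tau>\<close> puts
    \<open>\<tau> z\<close> inside \<open>root_map\<close>, where \<open>A_root\<close> removes the
    root.\<close>
  have "(\<integral>\<^sup>+z. A (root_map k z) \<partial>torus) = (\<integral>\<^sup>+z. A (root_map k z) \<partial>distr torus torus \<tau>)"
    by (simp add: \<tau>(2))
  also have "\<dots> = (\<integral>\<^sup>+z. A (root_map k (\<tau> z)) \<partial>torus)"
    by (rule nn_integral_distr[OF \<tau>(1)]) (simp only: measurable_distr_eq1, rule measurable_compose[OF measurable_root_map[OF k] A])
  also have "\<dots> = (\<integral>\<^sup>+z. A z \<partial>torus)" by (intro nn_integral_cong A_root)
  also have "\<dots> = (\<Sum>w\<in>torsion k. \<integral>\<^sup>+z. g (\<lambda>i. w i * z i) \<partial>torus)"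
    unfolding A_def by (intro nn_integral_sum g_rotate)
  also have "\<dots> = (\<Sum>w\<in>(torsion k :: ('n \<Rightarrow> complex) set). \<integral>\<^sup>+z. g z \<partial>torus)"
  proof (rule sum.cong[OF refl])
    fix w :: "'n \<Rightarrow> complex" assume w: "w \<in> torsion k"
    have "(\<integral>\<^sup>+z. g (\<lambda>i. w i * z i) \<partial>torus) = (\<integral>\<^sup>+z. g z \<partial>distr torus torus (\<lambda>z i. w i * z i))"
      by (rule nn_integral_distr[symmetric, OF rotate[OF w]]) simp
    thus "(\<integral>\<^sup>+z. g (\<lambda>i. w i * z i) \<partial>torus) = (\<integral>\<^sup>+z. g z \<partial>torus)"
      by (simp add: distr_torus_rotate(2)[OF torsion_subset_torus[OF k w]])
  qed
  finally show ?thesis by (simp add: A_def)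
qed

text \<open>The indicator of the exceptional set has integral 0, hence so has its sum over the
  fibres, and almost every fibre avoids the set. This makes the average well defined on
  classes.\<close>

lemma fibre_average_cong_AE:
  fixes f f' :: "('n::finite \<Rightarrow> complex) \<Rightarrow> complex"
  assumes k: "k > 0" and [measurable]: "f \<in> borel_measurable torus" "f' \<in> borel_measurable torus"
    and eq: "AE z in torus. f z = f' z"
  shows "AE z in torus. fibre_average k f z = fibre_average k f' z"
proof -
  define g :: "('n \<Rightarrow> complex) \<Rightarrow> ennreal" where "g z = (if f z = f' z then 0 else 1)" for z
  have [measurable]: "g \<in> borel_measurable torus" unfolding g_def by measurable
  have "(\<integral>\<^sup>+z. g z \<partial>torus) = 0"
    using eq by (subst nn_integral_0_iff_AE) (auto simp: g_def)
  with nn_integral_fibre_sum[OF k, of g]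
  have "(\<integral>\<^sup>+z. (\<Sum>w\<in>torsion k. g (\<lambda>i. w i * root_map k z i)) \<partial>torus) = 0" by simp
  moreover have "(\<lambda>z. \<Sum>w\<in>torsion k. g (\<lambda>i. w i * root_map k z i)) \<in> borel_measurable torus"
    by (intro borel_measurable_sum measurable_compose[OF measurable_torsion_root_map[OF k]]) auto
  ultimately have "AE z in torus. (\<Sum>w\<in>torsion k. g (\<lambda>i. w i * root_map k z i)) = 0"
    by (subst (asm) nn_integral_0_iff_AE) auto
  thus ?thesis
  proof eventually_elim
    case (elim z)
    hence "\<forall>w\<in>torsion k. g (\<lambda>i. w i * root_map k z i) = 0"
      using finite_torsion[OF k, where 'n = 'n] by (simp add: sum_eq_0_iff)
    hence "\<forall>w\<in>torsion k. f (\<lambda>i. w i * root_map k z i) = f' (\<lambda>i. w i * root_map k z i)"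
      by (auto simp: g_def split: if_splits)
    thus ?case by (simp add: fibre_average_def)
  qed
qed

text \<open>Triangle inequality, then Cauchy-Schwarz over the finite fibre.\<close>

lemma norm_fibre_average_le:
  fixes f :: "('n::finite \<Rightarrow> complex) \<Rightarrow> complex"
  assumes k: "k > 0"
  shows "(norm (fibre_average k f z))\<^sup>2 \<le>
           (\<Sum>w\<in>torsion k. (norm (f (\<lambda>i. w i * root_map k z i)))\<^sup>2) / card (torsion k :: ('n \<Rightarrow> complex) set)"
proof -
  let ?N = "real (card (torsion k :: ('n \<Rightarrow> complex) set))"
  let ?a = "\<lambda>w. norm (f (\<lambda>i. w i * root_map k z i))"
  have N: "?N > 0" using card_torsion_pos[OF k] by simp
  have "(norm (fibre_average k f z))\<^sup>2 = (norm (\<Sum>w\<in>torsion k. f (\<lambda>i. w i * root_map k z i)))\<^sup>2 / ?N\<^sup>2"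
    by (simp add: fibre_average_def norm_divide power_divide)
  also have "\<dots> \<le> (\<Sum>w\<in>torsion k. ?a w)\<^sup>2 / ?N\<^sup>2"
    by (intro divide_right_mono power_mono norm_sum) auto
  also have "\<dots> \<le> ((\<Sum>w\<in>torsion k. (?a w)\<^sup>2) * ?N) / ?N\<^sup>2"
    by (intro divide_right_mono sum_squared_le_sum_of_squares) auto
  also have "\<dots> = (\<Sum>w\<in>torsion k. (?a w)\<^sup>2) / ?N"
    using N by (simp add: power2_eq_square)
  finally show ?thesis .
qed

lemma nn_integral_fibre_average_le:
  fixes f :: "('n::finite \<Rightarrow> complex) \<Rightarrow> complex"
  assumes k: "k > 0" and [measurable]: "f \<in> borel_measurable torus"
  shows "(\<integral>\<^sup>+z. ennreal ((norm (fibre_average k f z))\<^sup>2) \<partial>torus) \<le> (\<integral>\<^sup>+z. ennreal ((norm (f z))\<^sup>2) \<partial>torus)"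
proof -
  let ?N = "card (torsion k :: ('n \<Rightarrow> complex) set)"
  \<comment> \<open>Dividing by the fibre size in advance cancels the factor that
    \<open>nn_integral_fibre_sum\<close> produces.\<close>
  define g where "g z = ennreal ((norm (f z))\<^sup>2 / real ?N)" for z
  have [measurable]: "g \<in> borel_measurable torus" unfolding g_def by measurable
  have N: "?N > 0" by (rule card_torsion_pos[OF k])
  have "(\<integral>\<^sup>+z. ennreal ((norm (fibre_average k f z))\<^sup>2) \<partial>torus) \<le>
          (\<integral>\<^sup>+z. (\<Sum>w\<in>torsion k. g (\<lambda>i. w i * root_map k z i)) \<partial>torus)"
    using ennreal_leI[OF norm_fibre_average_le[OF k, of f]]
    by (intro nn_integral_mono) (simp add: g_def sum_ennreal sum_divide_distrib)
  also have "\<dots> = of_nat ?N * (\<integral>\<^sup>+z. g z \<partial>torus)" by (rule nn_integral_fibre_sum[OF k]) simp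
  also have "\<dots> = (\<integral>\<^sup>+z. of_nat ?N * g z \<partial>torus)" by (rule nn_integral_cmult[symmetric]) simp
  also have "\<dots> = (\<integral>\<^sup>+z. ennreal ((norm (f z))\<^sup>2) \<partial>torus)"
  proof -
    have "of_nat ?N * g z = ennreal ((norm (f z))\<^sup>2)" for z
      using N by (simp add: g_def ennreal_of_nat_eq_real_of_nat flip: ennreal_mult')
    thus ?thesis by (intro nn_integral_cong)
  qed
  finally show ?thesis .
qed

lemma square_integrable_fibre_average:
  assumes k: "k > 0" and f: "square_integrable f"
  shows "square_integrable (fibre_average k f)"
    and "(\<integral>z. (norm (fibre_average k f z))\<^sup>2 \<partial>torus) \<le> (\<integral>z. (norm (f z))\<^sup>2 \<partial>torus)"
proof -
  have [measurable]: "f \<in> borel_measurable torus" and int: "integrable torus (\<lambda>z. (norm (f z))\<^sup>2)"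
    using f by (auto simp: square_integrable_def)
  have [measurable]: "fibre_average k f \<in> borel_measurable torus"
    by (rule measurable_fibre_average[OF k]) simp
  have le: "(\<integral>\<^sup>+z. ennreal ((norm (fibre_average k f z))\<^sup>2) \<partial>torus) \<le> ennreal (\<integral>z. (norm (f z))\<^sup>2 \<partial>torus)"
    using nn_integral_fibre_average_le[OF k, of f] nn_integral_eq_integral[OF int] by simp
  have "(\<integral>\<^sup>+z. ennreal ((norm (fibre_average k f z))\<^sup>2) \<partial>torus) < \<infinity>"
    using le_less_trans[OF le ennreal_less_top] by simp
  hence int': "integrable torus (\<lambda>z. (norm (fibre_average k f z))\<^sup>2)"
    by (intro integrableI_bounded) auto
  thus "square_integrable (fibre_average k f)" by (simp add: square_integrable_def)
  show "(\<integral>z. (norm (fibre_average k f z))\<^sup>2 \<partial>torus) \<le> (\<integral>z. (norm (f z))\<^sup>2 \<partial>torus)"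
    using le nn_integral_eq_integral[OF int'] by (simp add: integral_nonneg)
qed

text \<open>Orthogonality on the finite group of torsion points: a character trivial on the group
  survives averaging with only the root left to evaluate, while a nontrivial one has sum 0.\<close>

lemma fibre_average_char:
  fixes m :: "'n::finite \<Rightarrow> int"
  assumes k: "k > 0" and z: "z \<in> space torus"
  shows "fibre_average k (torus_char m) z =
           (if \<forall>i. int k dvd m i then torus_char (\<lambda>i. - (m i div int k)) z else 0)"
proof -
  let ?N = "card (torsion k :: ('n \<Rightarrow> complex) set)"
  have mult: "torus_char m (\<lambda>i. v i * w i) = torus_char m v * torus_char m w" for v w :: "'n \<Rightarrow> complex"
    by (simp add: torus_char_def power_int_mult_distrib prod.distrib)
  have *: "fibre_average k (torus_char m) z =
          (\<Sum>w\<in>torsion k. torus_char m w) * torus_char m (root_map k z) / of_nat ?N"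
    by (simp add: fibre_average_def mult sum_distrib_right)
  show ?thesis
  proof (cases "\<forall>i. int k dvd m i")
    case True
    have powi: "x powi m i = (x ^ k) powi (m i div int k)" for x :: complex and i
    proof -
      have "x powi m i = x powi (int k * (m i div int k))" using True by simp
      also have "\<dots> = (x ^ k) powi (m i div int k)" by (simp only: power_int_mult power_int_of_nat)
      finally show ?thesis .
    qed
    have "torus_char m w = 1" if "w \<in> torsion k" for w
      using that by (simp add: torus_char_def powi torsion_def)
    moreover have "torus_char m (root_map k z) = torus_char (\<lambda>i. - (m i div int k)) z"
      by (simp add: torus_char_def powi root_map_power[OF k z] power_int_minus power_int_inverse)
    ultimately show ?thesis using True card_torsion_pos[OF k, where 'n = 'n] by (simp add: *)
  next
    case False
    then obtain l where l: "\<not> int k dvd m l" by blast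
    \<comment> \<open>A primitive k-th root of unity in the single coordinate \<open>l\<close>.
      Translation by \<open>u\<close> multiplies the sum by \<open>torus_char m u\<close>, which
      differs from 1 because k does not divide \<open>m l\<close>; so the sum is 0.\<close>
    define u :: "'n \<Rightarrow> complex" where "u i = (if i = l then cis (2 * pi / k) else 1)" for i
    have "cis (2 * pi / k) ^ k = 1" by (subst Complex.DeMoivre) (use k in simp)
    hence "u \<in> torsion k" by (simp add: torsion_def u_def)
    from sum_torsion_translate[OF this k, of "torus_char m"]
    have "(\<Sum>w\<in>torsion k. torus_char m w) * torus_char m u = (\<Sum>w\<in>torsion k. torus_char m w)"
      by (simp add: mult sum_distrib_right)
    moreover have "torus_char m u \<noteq> 1"
    proof
      assume "torus_char m u = 1"
      moreover have "torus_char m u = (\<Prod>i\<in>UNIV. if i = l then cis (2 * pi / k) powi m i else 1)"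
        unfolding torus_char_def by (intro prod.cong) (auto simp: u_def)
      ultimately have "cis (m l * (2 * pi / k)) = 1" by (simp add: cis_power_int)
      hence "cos (m l * (2 * pi / k)) = 1" by (simp add: complex_eq_iff)
      then obtain j :: int where "m l * (2 * pi / k) = of_int j * 2 * pi"
        by (auto simp: cos_one_2pi_int)
      hence "of_int (m l) = (of_int (j * int k) :: real)" using k by (simp add: field_simps)
      hence "m l = j * int k" by (simp only: of_int_eq_iff)
      with l show False by simp
    qed
    ultimately have "(\<Sum>w\<in>(torsion k :: ('n \<Rightarrow> complex) set). torus_char m w) = 0" by simp
    thus ?thesis unfolding if_not_P[OF False] by (simp add: *)
  qed
qed

section \<open>The averaging operator on classes\<close>

lemma abs_torus_L2_cong:
  "square_integrable f \<Longrightarrow> square_integrable g \<Longrightarrow> (AE z in torus. f z = g z) \<Longrightarrow>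
     abs_torus_L2 f = abs_torus_L2 g"
  by (intro Quotient_rel_abs[OF Quotient_torus_L2]) (simp add: L2_rel_def)

lemma V_op_exists:
  assumes k: "k > 0"
  shows "\<exists>V :: 'n::finite torus_L2 \<Rightarrow> 'n torus_L2. bounded_operator V \<and>
           (\<forall>m. V (monomial m) = (if \<forall>i. int k dvd m i then monomial (\<lambda>i. - (m i div int k)) else 0))"
proof -
  \<comment> \<open>The representative is an arbitrary choice; the fact \<open>V\<close> shows that
    any other gives the same class.\<close>
  define V :: "'n torus_L2 \<Rightarrow> 'n torus_L2" where
    "V x = abs_torus_L2 (fibre_average k (rep_torus_L2 x))" for x
  note sq = square_integrable_fibre_average(1)[OF k]
  have V: "V (abs_torus_L2 f) = abs_torus_L2 (fibre_average k f)" if f: "square_integrable f" for f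
  proof -
    have "L2_rel (rep_torus_L2 (abs_torus_L2 f)) f"
      by (rule Quotient_rep_abs[OF Quotient_torus_L2]) (simp add: L2_rel_refl f)
    thus ?thesis unfolding V_def
      by (intro abs_torus_L2_cong sq fibre_average_cong_AE[OF k])
         (auto simp: L2_rel_def square_integrable_def)
  qed
  have "norm (V x) \<le> 1 * norm x" for x
  proof (rule torus_L2_cases[of x])
    fix f assume f: "square_integrable f" "x = abs_torus_L2 f"
    have "(norm (V x))\<^sup>2 \<le> (norm x)\<^sup>2"
      using square_integrable_fibre_average[OF k f(1)] f by (simp add: V norm_abs_L2)
    thus "norm (V x) \<le> 1 * norm x" by (simp add: power2_le_iff_abs_le)
  qed
  moreover have "V (x + y) = V x + V y" for x y
  proof (rule torus_L2_cases[of x], rule torus_L2_cases[of y])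
    fix f g assume "square_integrable f" "x = abs_torus_L2 f" "square_integrable g" "y = abs_torus_L2 g"
    moreover have "fibre_average k (\<lambda>z. f z + g z) = (\<lambda>z. fibre_average k f z + fibre_average k g z)"
      by (auto simp: fibre_average_def sum.distrib add_divide_distrib)
    ultimately show ?thesis by (simp add: plus_abs_L2 V square_integrable_add sq)
  qed
  moreover have "V (c *\<^sub>C x) = c *\<^sub>C V x" for c x
  proof (rule torus_L2_cases[of x])
    fix f assume "square_integrable f" "x = abs_torus_L2 f"
    moreover have "fibre_average k (\<lambda>z. c * f z) = (\<lambda>z. c * fibre_average k f z)"
      by (auto simp: fibre_average_def sum_distrib_left)
    ultimately show ?thesis by (simp add: scaleC_abs_L2 V square_integrable_cmult sq)
  qed
  moreover have "V (monomial m) = (if \<forall>i. int k dvd m i then monomial (\<lambda>i. - (m i div int k)) else 0)" for m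
  proof -
    have zero: "(0 :: 'n torus_L2) = abs_torus_L2 (\<lambda>_. 0)" by (rule zero_torus_L2.abs_eq)
    have "V (monomial m) = abs_torus_L2 (fibre_average k (torus_char m))"
      by (simp add: monomial_eq V square_integrable_char)
    also have "\<dots> = abs_torus_L2 (if \<forall>i. int k dvd m i then torus_char (\<lambda>i. - (m i div int k)) else (\<lambda>_. 0))"
      by (intro abs_torus_L2_cong sq square_integrable_char)
         (auto simp: fibre_average_char[OF k] square_integrable_char square_integrable_0)
    finally show ?thesis by (simp add: monomial_eq zero)
  qed
  ultimately show ?thesis unfolding bounded_operator_def complex_linear_def by blast
qed

lemma V_op:
  assumes k: "k > 0"
  shows bounded_operator_V_op: "bounded_operator (V_op k :: 'n::finite torus_L2 \<Rightarrow> 'n torus_L2)"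
    and V_op_monomial: "V_op k (monomial m :: 'n torus_L2) =
           (if \<forall>i. int k dvd m i then monomial (\<lambda>i. - (m i div int k)) else 0)"
proof -
  let ?P = "\<lambda>V :: 'n torus_L2 \<Rightarrow> 'n torus_L2. bounded_operator V \<and>
     (\<forall>m. V (monomial m) = (if \<forall>i. int k dvd m i then monomial (\<lambda>i. - (m i div int k)) else 0))"
  have "\<exists>!V. ?P V"
  proof (rule ex_ex1I)
    show "\<exists>V. ?P V" by (rule V_op_exists[OF k])
    show "V = W" if "?P V" "?P W" for V W
      using that by (intro bounded_operator_eqI) simp_all
  qed
  from theI'[OF this] have "?P (V_op k)" by (simp add: V_op_def)
  thus "bounded_operator (V_op k :: 'n torus_L2 \<Rightarrow> 'n torus_L2)"
    "V_op k (monomial m :: 'n torus_L2) =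
       (if \<forall>i. int k dvd m i then monomial (\<lambda>i. - (m i div int k)) else 0)" by blast+
qed

subsection \<open>The adjoint relation and compactness\<close>

text \<open>Both sides are continuous and real-linear in \<open>x\<close>, so monomials decide;
  there each side can be nonzero only for the index -kj. The free scalar \<open>c\<close> captures
  the full Hermitian pairing.\<close>

lemma inner_V_op:
  fixes x :: "'n::finite torus_L2"
  assumes k: "k > 0"
  shows "inner (V_op k x) (c *\<^sub>C monomial j) = inner x (c *\<^sub>C monomial (\<lambda>i. - (int k * j i)))"
proof -
  note V = bounded_operator_V_op[OF k, where 'n = 'n]
  have lin: "V_op k (x + y) = V_op k x + V_op k y" "V_op k (d *\<^sub>C x) = d *\<^sub>C V_op k x"
    for x y :: "'n torus_L2" and d
    using V by (auto simp: bounded_operator_def complex_linear_def)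
  \<comment> \<open>A scalar factor of \<open>x\<close> moves to the right argument and changes
    \<open>c\<close>, hence the quantifier.\<close>
  have "\<forall>c. inner (V_op k x) (c *\<^sub>C monomial j) = inner x (c *\<^sub>C monomial (\<lambda>i. - (int k * j i)))"
  proof (induction x rule: torus_L2_induct)
    case (monomial m)
    show ?case
    proof (cases "\<forall>i. int k dvd m i")
      case True
      define l where "l i = m i div int k" for i
      have "m = (\<lambda>i. int k * l i)" using True by (simp add: l_def)
      moreover have "- l i = j i \<longleftrightarrow> int k * l i = - (int k * j i)" for i
      proof -
        have "int k * l i = int k * (- j i) \<longleftrightarrow> l i = - j i"
          using k by (subst mult_cancel_left) auto
        thus ?thesis by auto
      qed
      ultimately have "(\<lambda>i. - (m i div int k)) = j \<longleftrightarrow> m = (\<lambda>i. - (int k * j i))"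
        using k by (simp add: fun_eq_iff)
      thus ?thesis using True by (simp add: V_op_monomial[OF k] inner_monomial)
    next
      case False
      hence "m \<noteq> (\<lambda>i. - (int k * j i))" by auto
      moreover have "V_op k (monomial m) = 0"
        unfolding V_op_monomial[OF k] by (rule if_not_P[OF False])
      ultimately show ?thesis by (simp add: inner_monomial)
    qed
  next
    case closed
    have "closed (\<Inter>c. {x. inner (V_op k x) (c *\<^sub>C monomial j) =
                           inner x (c *\<^sub>C monomial (\<lambda>i. - (int k * j i)))})"
      by (intro closed_INT ballI closed_Collect_eq continuous_intros linear_continuous_on
            bounded_operator_imp_bounded_linear V)
    thus ?case by (simp add: Collect_all_eq)
  qed (simp_all add: lin inner_scaleC_L2 inner_add_left)
  thus ?thesis by blast
qed

section \<open>Multiplication operators and weak convergence\<close>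

lemma torus_Linf_cases:
  obtains f where "ess_bounded f" "\<phi> = abs_torus_Linf f"
proof -
  have "Linf_rel (rep_torus_Linf \<phi>) (rep_torus_Linf \<phi>)"
    by (rule Quotient_rep_reflp[OF Quotient_torus_Linf])
  moreover have "\<phi> = abs_torus_Linf (rep_torus_Linf \<phi>)"
    by (simp add: Quotient_abs_rep[OF Quotient_torus_Linf])
  ultimately show ?thesis using that by (auto simp: Linf_rel_def)
qed

lemma mult_op_abs:
  "ess_bounded \<phi> \<Longrightarrow> square_integrable f \<Longrightarrow>
     mult_op (abs_torus_Linf \<phi>) (abs_torus_L2 f) = abs_torus_L2 (\<lambda>z. \<phi> z * f z)"
  by (simp add: mult_op.abs_eq L2_rel_refl Linf_rel_def)

text \<open>A character times the conjugate of another depends only on the difference of the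
  indices, so the matrix of a multiplication operator is constant along diagonals. The entry is the
  Fourier coefficient of the symbol at -q.\<close>

lemma inner_mult_op_monomial:
  fixes \<phi> :: "'n::finite torus_Linf"
  assumes eq: "\<And>i. m i - j i = q i"
  shows "inner (mult_op \<phi> (monomial m)) (c *\<^sub>C monomial j) = inner (mult_op \<phi> (monomial q)) (c *\<^sub>C monomial (\<lambda>_. 0))"
proof (rule torus_Linf_cases[of \<phi>])
  fix f assume f: "ess_bounded f" "\<phi> = abs_torus_Linf f"
  have *: "inner (mult_op \<phi> (monomial m)) (c *\<^sub>C monomial j) =
          Re (\<integral>z. f z * torus_char m z * cnj (c * torus_char j z) \<partial>torus)" for m j
    using f by (simp add: monomial_eq mult_op_abs scaleC_abs_L2 inner_abs_L2 square_integrable_char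
                  square_integrable_cmult square_integrable_mult)
  have "(\<integral>z. f z * torus_char m z * cnj (c * torus_char j z) \<partial>torus) =
        (\<integral>z. f z * torus_char q z * cnj (c * torus_char (\<lambda>_. 0) z) \<partial>torus)"
  proof (intro Bochner_Integration.integral_cong refl)
    fix z :: "'n \<Rightarrow> complex" assume z: "z \<in> space torus"
    have "q = (\<lambda>i. m i + - j i)" using eq by (simp add: fun_eq_iff)
    hence "torus_char q z = torus_char m z * cnj (torus_char j z)"
      using torus_char_add[OF z, of m "\<lambda>i. - j i"] by (simp add: cnj_torus_char[OF z])
    thus "f z * torus_char m z * cnj (c * torus_char j z) = f z * torus_char q z * cnj (c * torus_char (\<lambda>_. 0) z)"
      by simp
  qed
  thus ?thesis by (simp only: *)
qed

text \<open>By Bessel's inequality the squared coefficients are summable.\<close>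

lemma inner_orthonormal_tendsto_zero:
  fixes u :: "nat \<Rightarrow> 'a::real_inner"
  assumes "\<And>i j. inner (u i) (u j) = (if i = j then 1 else 0)"
  shows "(\<lambda>i. inner y (u i)) \<longlonglongrightarrow> 0"
proof -
  have "(\<Sum>i<n. (inner y (u i))\<^sup>2) \<le> inner y y" for n
  proof -
    \<comment> \<open>The orthogonal projection of \<open>y\<close> onto the span of the first
      \<open>n\<close> vectors.\<close>
    define s where "s = (\<Sum>i<n. inner y (u i) *\<^sub>R u i)"
    have ys: "inner y s = (\<Sum>i<n. (inner y (u i))\<^sup>2)"
      by (simp add: s_def inner_sum_right power2_eq_square)
    have "inner s (u i) = inner y (u i)" if "i < n" for i
      using that by (simp add: s_def inner_sum_left assms if_distrib cong: if_cong)
    hence ss: "inner s s = (\<Sum>i<n. (inner y (u i))\<^sup>2)"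
      by (subst (2) s_def) (simp add: inner_sum_right power2_eq_square)
    have "0 \<le> inner (y - s) (y - s)" by simp
    also have "\<dots> = inner y y - (\<Sum>i<n. (inner y (u i))\<^sup>2)"
      using ys ss by (simp add: inner_diff inner_commute)
    finally show ?thesis by simp
  qed
  hence "summable (\<lambda>i. (inner y (u i))\<^sup>2)"
    by (intro summableI_nonneg_bounded[where x = "inner y y"]) auto
  hence "(\<lambda>i. (inner y (u i))\<^sup>2) \<longlonglongrightarrow> 0" by (rule summable_LIMSEQ_zero)
  from tendsto_real_sqrt[OF this] have "(\<lambda>i. \<bar>inner y (u i)\<bar>) \<longlonglongrightarrow> 0" by simp
  thus ?thesis by (simp only: tendsto_rabs_zero_iff)
qed

text \<open>The monomial of index 0 is the constant 1, so the assumption says that the symbol itself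
  vanishes almost everywhere.\<close>

lemma mult_op_eq_zeroI:
  fixes \<phi> :: "'n::finite torus_Linf"
  assumes "mult_op \<phi> (monomial (\<lambda>_. 0)) = 0"
  shows "mult_op \<phi> x = 0"
proof (rule torus_Linf_cases[of \<phi>], rule torus_L2_cases[of x])
  fix f g assume f: "ess_bounded f" "\<phi> = abs_torus_Linf f" and g: "square_integrable g" "x = abs_torus_L2 g"
  have one: "square_integrable (\<lambda>_. 1)" using square_integrable_char[of "\<lambda>_. 0"] by (simp add: torus_char_0[abs_def])
  have "monomial (\<lambda>_. 0) = abs_torus_L2 (\<lambda>_::'n \<Rightarrow> complex. 1)" by (simp add: monomial_eq torus_char_0[abs_def])
  hence zero: "abs_torus_L2 f = 0" "square_integrable f"
    using assms f mult_op_abs[OF f(1) one] square_integrable_mult[OF f(1) one] by auto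
  have "L2_rel f (\<lambda>_. 0)"
    using zero Quotient_rel[OF Quotient_torus_L2, of f "\<lambda>_. 0"]
    by (simp add: L2_rel_refl square_integrable_0 zero_torus_L2.abs_eq)
  hence "AE z in torus. f z * g z = 0" by (auto simp: L2_rel_def)
  hence "abs_torus_L2 (\<lambda>z. f z * g z) = abs_torus_L2 (\<lambda>_. 0)"
    by (intro abs_torus_L2_cong square_integrable_mult square_integrable_0 f g)
  thus ?thesis using f g by (simp add: mult_op_abs zero_torus_L2.abs_eq)
qed

text \<open>The vector in the conclusion is the symbol regarded as an element of
  \<open>torus_L2\<close>; its Fourier coefficients are shown to vanish one at a time.\<close>

lemma compact_slant_Hankel_imp_zero:
  fixes \<phi> :: "'n::finite torus_Linf"
  assumes k: "k > 0" and compact: "compact_operator (slant_Hankel k \<phi>)"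
  shows "mult_op \<phi> (monomial (\<lambda>_. 0)) = 0"
proof (rule inner_zero_monomials)
  fix c :: complex and p :: "'n \<Rightarrow> int"
  let ?T = "slant_Hankel k \<phi>"
  define q where "q i = - p i" for i
  \<comment> \<open>Modulus 1 makes the vectors \<open>u t\<close> orthonormal. For
    \<open>c = 0\<close> the quotient is 0 by convention, and that case is treated apart.\<close>
  define d where "d = c / norm c"
  define a where "a = inner (mult_op \<phi> (monomial q)) (d *\<^sub>C monomial (\<lambda>_. 0))"
  \<comment> \<open>Pairing with \<open>u t\<close> through \<open>V_op k\<close> uses the index
    -kt, and (q - kt) - (-kt) = q, so all these pairings have the common value
    \<open>a\<close>.\<close>
  define x where "x t = (monomial (\<lambda>i. q i - int k * int t) :: 'n torus_L2)" for t :: nat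
  define u where "u t = d *\<^sub>C (monomial (\<lambda>_. int t) :: 'n torus_L2)" for t :: nat
  have inner_T: "inner (?T (x t)) (u t) = a" for t
  proof -
    have "inner (?T (x t)) (u t) =
            inner (mult_op \<phi> (x t)) (d *\<^sub>C monomial (\<lambda>i. - (int k * int t)))"
      by (simp add: slant_Hankel_def u_def inner_V_op[OF k])
    also have "\<dots> = a" unfolding x_def a_def by (rule inner_mult_op_monomial) simp
    finally show ?thesis .
  qed
  have "a = 0" if "c \<noteq> 0"
  proof -
    have d: "norm d = 1" using that by (simp add: d_def norm_divide)
    hence dd: "cnj d * d = 1" using complex_norm_square[of d] by (simp add: mult.commute)
    have "inner (u s) (u t) = (if s = t then 1 else 0)" for s t
      by (simp add: u_def inner_scaleC_L2 dd inner_monomial[of _ 1, simplified] fun_eq_iff)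
    note lim_u = inner_orthonormal_tendsto_zero[of u, OF this]
    have norm_u: "norm (u t) = 1" for t by (simp add: u_def norm_scaleC_L2 d)
    have "bounded (range x)" by (auto simp: bounded_iff x_def intro!: exI[of _ 1])
    hence compact': "seq_compact (closure (?T ` range x))"
      using compact by (simp add: compact_operator_def compact_eq_seq_compact_metric)
    have mem: "\<forall>t. ?T (x t) \<in> closure (?T ` range x)"
      by (intro allI subsetD[OF closure_subset]) auto
    obtain y r where r: "strict_mono r" "(\<lambda>t. ?T (x (r t))) \<longlonglongrightarrow> y"
      using seq_compactE[OF compact' mem] unfolding comp_def by blast
    \<comment> \<open>The constant \<open>a\<close> splits into the pairings of \<open>u\<close>
      with the error and with the limit \<open>y\<close>. Norm convergence and Cauchy-Schwarz kill
      the first, weak convergence of \<open>u\<close> to 0 the second.\<close>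
    have "(\<lambda>t. inner (?T (x (r t)) - y) (u (r t))) \<longlonglongrightarrow> 0"
    proof (rule Lim_null_comparison)
      show "(\<lambda>t. norm (?T (x (r t)) - y)) \<longlonglongrightarrow> 0"
        using tendsto_norm[OF tendsto_diff[OF r(2) tendsto_const], of y] by simp
      show "\<forall>\<^sub>F t in sequentially. norm (inner (?T (x (r t)) - y) (u (r t))) \<le> norm (?T (x (r t)) - y)"
      proof (rule always_eventually, rule allI)
        fix t
        show "norm (inner (?T (x (r t)) - y) (u (r t))) \<le> norm (?T (x (r t)) - y)"
          using Cauchy_Schwarz_ineq2[of "?T (x (r t)) - y" "u (r t)"] by (simp add: norm_u)
      qed
    qed
    moreover have "(\<lambda>t. inner y (u (r t))) \<longlonglongrightarrow> 0"
      using LIMSEQ_subseq_LIMSEQ[OF lim_u[of y] r(1)] by (simp add: comp_def)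
    ultimately have "(\<lambda>t. inner (?T (x (r t)) - y) (u (r t)) + inner y (u (r t))) \<longlonglongrightarrow> 0 + 0"
      by (rule tendsto_add)
    hence "(\<lambda>_::nat. a) \<longlonglongrightarrow> 0" by (simp add: inner_diff_left inner_T)
    thus "a = 0" by (simp add: LIMSEQ_const_iff)
  qed
  moreover have "inner (mult_op \<phi> (monomial (\<lambda>_. 0))) (c *\<^sub>C monomial p) = norm c * a"
  proof -
    \<comment> \<open>Undoes the normalization: \<open>norm c\<close> is a real factor and leaves
      the real inner product.\<close>
    have "c *\<^sub>C monomial (\<lambda>_. 0) = norm c *\<^sub>R (d *\<^sub>C (monomial (\<lambda>_. 0) :: 'n torus_L2))"
      by (cases "c = 0") (simp_all add: scaleR_L2 d_def)
    moreover have "inner (mult_op \<phi> (monomial (\<lambda>_. 0))) (c *\<^sub>C monomial p) =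
            inner (mult_op \<phi> (monomial q)) (c *\<^sub>C monomial (\<lambda>_. 0))"
      by (rule inner_mult_op_monomial) (simp add: q_def)
    ultimately show ?thesis by (simp add: a_def)
  qed
  ultimately show "inner (mult_op \<phi> (monomial (\<lambda>_. 0))) (c *\<^sub>C monomial p) = 0" by auto
qed

theorem theorem3p6:
  fixes k :: nat
  assumes "k \<ge> 2"
  shows "{T :: 'n::finite torus_L2 \<Rightarrow> 'n torus_L2. slant_Hankel_operator k T \<and> compact_operator T}
           = {\<lambda>_. 0}"
proof -
  have k: "k > 0" using assms by simp
  have V_0: "V_op k (0 :: 'n torus_L2) = 0"
    using linear_0[OF bounded_linear.linear[OF bounded_operator_imp_bounded_linear[OF bounded_operator_V_op[OF k]]]] .
  have zero: "slant_Hankel k \<phi> = (\<lambda>_. 0)" if "mult_op \<phi> (monomial (\<lambda>_. 0)) = 0" for \<phi> :: "'n torus_Linf"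
    by (simp add: slant_Hankel_def comp_def mult_op_eq_zeroI[OF that] V_0)
  \<comment> \<open>The zero operator has the symbol 0.\<close>
  have "slant_Hankel_operator k (\<lambda>_. 0 :: 'n torus_L2)"
  proof -
    have "mult_op (abs_torus_Linf (\<lambda>_. 0)) (monomial (\<lambda>_::'n. 0)) = 0"
      by (simp add: monomial_eq mult_op_abs ess_bounded_const square_integrable_char zero_torus_L2.abs_eq)
    from zero[OF this] show ?thesis unfolding slant_Hankel_operator_def by metis
  qed
  moreover have "compact_operator (\<lambda>_. 0 :: 'n torus_L2)"
  proof -
    \<comment> \<open>Only an inclusion, because the image is empty for empty \<open>B\<close>; the
      closure is finite in either case.\<close>
    have "(\<lambda>_. 0 :: 'n torus_L2) ` B \<subseteq> {0}" for B :: "'n torus_L2 set" by auto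
    hence "compact (closure ((\<lambda>_. 0 :: 'n torus_L2) ` B))" for B :: "'n torus_L2 set"
      by (intro finite_imp_compact) (meson closure_minimal closed_singleton finite.intros finite_subset)
    moreover have "c *\<^sub>C 0 = (0 :: 'n torus_L2)" for c
      using norm_scaleC_L2[of c 0] by simp
    ultimately show ?thesis by (simp add: compact_operator_def complex_linear_def)
  qed
  moreover have "T = (\<lambda>_. 0)" if "slant_Hankel_operator k T" "compact_operator T" for T :: "'n torus_L2 \<Rightarrow> _"
    using that compact_slant_Hankel_imp_zero[OF k] zero by (auto simp: slant_Hankel_operator_def)
  ultimately show ?thesis by blast
qed

end
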